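(* Let $f\in H^2(\mathbb{B})$, let $I,J\in\mathbb{S}$ with $J$ orthogonal to $I$, and let $F,G:\mathbb{B}_I\to L_I\cong\mathbb{C}$ be holomorphic functions such that $f_I(z)=F(z)+G(z)J$ for every $z\in\mathbb{B}_I$. Then $f$ is inner if and only if for Lebesgue-almost every $z\in\partial\mathbb{B}_I$ both of the following conditions hold: $$|F(z)|^2+|G(z)|^2=1\qquad\text{and}\qquad F(z)G(\overline z)=F(\overline z)G(z).$$
   Context: $\mathbb{H}$ is the skew field of quaternions, $\mathbb{B}=\{q\in\mathbb{H}:|q|<1\}$, $\mathbb{S}=\{q\in\mathbb{H}:q^2=-1\}$ (the $2$-sphere of imaginary units, orthogonality being with respect to the Euclidean inner product of $\mathbb{H}\cong\mathbb{R}^4$). For $I\in\mathbb{S}$, $L_I=\mathbb{R}+\mathbb{R}I\cong\mathbb{C}$, $\mathbb{B}_I=\mathbb{B}\cap L_I$, $\partial\mathbb{B}_I=\partial\mathbb{B}\cap L_I$, and $f_I$ is the restriction of $f$ to $\mathbb{B}_I$. A function $f:\mathbb{B}\to\mathbb{H}$ is slice regular if, for every $I\in\mathbb{S}$, $f_I$ has continuous partial derivatives and $\frac12(\partial_x+I\partial_y)f_I(x+yI)=0$; equivalently $f(q)=\sum_{n\ge0}q^na_n$ on $\mathbb{B}$ with $a_n\in\mathbb{H}$. For every slice regular $f$ and all $I,J\in\mathbb{S}$ with $J\perp I$, holomorphic $F,G:\mathbb{B}_I\to L_I$ with $f_I=F+GJ$ exist (Splitting Lemma). $H^2(\mathbb{B})$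 is the space of slice regular functions $f(q)=\sum_{n\ge0}q^na_n$ with $(a_n)\in\ell^2(\mathbb{N},\mathbb{H})$; $H^\infty(\mathbb{B})$ is the space of bounded slice regular functions on $\mathbb{B}$. The boundary $\partial\mathbb{B}=\{e^{tI}=\cos t+\sin t\,I:I\in\mathbb{S},t\in\mathbb{R}\}$ carries the measure $d\Sigma(e^{tI})=d\sigma(I)\,dt$, with $dt$ Lebesgue measure on $[0,2\pi)$ and $d\sigma$ the standard area element of $\mathbb{S}$, normalized so that $\Sigma(\partial\mathbb{B})=1$. Functions in $H^2(\mathbb{B})$ (and the corresponding components $F,G$) are evaluated on the boundary via their a.e. existing radial boundary values. A function $\varphi\in H^\infty(\mathbb{B})$ is inner if $|\varphi(q)|\le1$ on $\mathbb{B}$ and $|\varphi(q)|=1$ for $\Sigma$-a.e. $q\in\partial\mathbb{B}$. *)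

theory Defs
  imports "HOL-Complex_Analysis.Complex_Analysis"
begin

section \<open>The skew field of quaternions\<close>

datatype quat = Quat (qRe: real) (qI: real) (qJ: real) (qK: real)

lemma quat_eq_iff: "p = q \<longleftrightarrow> qRe p = qRe q \<and> qI p = qI q \<and> qJ p = qJ q \<and> qK p = qK q"
  by (cases p; cases q) auto

instantiation quat :: ring_1
begin

definition "0 = Quat 0 0 0 0"
definition "1 = Quat 1 0 0 0"
definition "p + q = Quat (qRe p + qRe q) (qI p + qI q) (qJ p + qJ q) (qK p + qK q)"
definition "p - q = Quat (qRe p - qRe q) (qI p - qI q) (qJ p - qJ q) (qK p - qK q)"
definition "- p = Quat (- qRe p) (- qI p) (- qJ p) (- qK p)"
definition "p * q = Quat
  (qRe p * qRe q - qI p * qI q - qJ p * qJ q - qK p * qK q)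
  (qRe p * qI q + qI p * qRe q + qJ p * qK q - qK p * qJ q)
  (qRe p * qJ q - qI p * qK q + qJ p * qRe q + qK p * qI q)
  (qRe p * qK q + qI p * qJ q - qJ p * qI q + qK p * qRe q)"

instance
  by standard
    (simp_all add: zero_quat_def one_quat_def plus_quat_def minus_quat_def uminus_quat_def
      times_quat_def algebra_simps)

end

lemma quat_ring_sel [simp]:
  "qRe 0 = 0" "qI 0 = 0" "qJ 0 = 0" "qK 0 = 0"
  "qRe 1 = 1" "qI 1 = 0" "qJ 1 = 0" "qK 1 = 0"
  "qRe (p + q) = qRe p + qRe q" "qI (p + q) = qI p + qI q"
  "qJ (p + q) = qJ p + qJ q" "qK (p + q) = qK p + qK q"
  "qRe (p - q) = qRe p - qRe q" "qI (p - q) = qI p - qI q"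
  "qJ (p - q) = qJ p - qJ q" "qK (p - q) = qK p - qK q"
  "qRe (- p) = - qRe p" "qI (- p) = - qI p" "qJ (- p) = - qJ p" "qK (- p) = - qK p"
  by (simp_all add: zero_quat_def one_quat_def plus_quat_def minus_quat_def uminus_quat_def)

lemma quat_times_sel [simp]:
  "qRe (p * q) = qRe p * qRe q - qI p * qI q - qJ p * qJ q - qK p * qK q"
  "qI (p * q) = qRe p * qI q + qI p * qRe q + qJ p * qK q - qK p * qJ q"
  "qJ (p * q) = qRe p * qJ q - qI p * qK q + qJ p * qRe q + qK p * qI q"
  "qK (p * q) = qRe p * qK q + qI p * qJ q - qJ p * qI q + qK p * qRe q"
  by (simp_all add: times_quat_def)

instantiation quat :: real_algebra_1
begin

definition "scaleR r q = Quat (r * qRe q) (r * qI q) (r * qJ q) (r * qK q)"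

instance
  by standard (simp_all add: quat_eq_iff scaleR_quat_def algebra_simps)

end

lemma quat_scaleR_sel [simp]:
  "qRe (r *\<^sub>R q) = r * qRe q" "qI (r *\<^sub>R q) = r * qI q"
  "qJ (r *\<^sub>R q) = r * qJ q" "qK (r *\<^sub>R q) = r * qK q"
  by (simp_all add: scaleR_quat_def)

lemma quat_of_real_sel [simp]:
  "qRe (of_real r) = r" "qI (of_real r) = 0" "qJ (of_real r) = 0" "qK (of_real r) = 0"
  by (simp_all add: of_real_def)

instantiation quat :: real_inner
begin

definition "inner p q = qRe p * qRe q + qI p * qI q + qJ p * qJ q + qK p * qK q"
  for p q :: quat
definition "norm q = sqrt (inner q q)" for q :: quat
definition "sgn q = q /\<^sub>R norm q" for q :: quat
definition "dist p q = norm (p - q)" for p q :: quat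
definition [code del]:
  "(uniformity :: (quat \<times> quat) filter) = (INF e\<in>{0<..}. principal {(x, y). dist x y < e})"
definition [code del]:
  "open (U :: quat set) \<longleftrightarrow> (\<forall>x\<in>U. eventually (\<lambda>(x', y). x' = x \<longrightarrow> y \<in> U) uniformity)"

instance
proof
  fix p q r :: quat and a :: real
  show "inner p q = inner q p" "inner (p + q) r = inner p r + inner q r"
    "inner (a *\<^sub>R p) q = a * inner p q"
    by (simp_all add: inner_quat_def algebra_simps)
  show "0 \<le> inner p p"
    by (simp add: inner_quat_def)
  show "inner p p = 0 \<longleftrightarrow> p = 0"
  proof
    assume "inner p p = 0"
    then have "(qRe p)\<^sup>2 + (qI p)\<^sup>2 + (qJ p)\<^sup>2 + (qK p)\<^sup>2 = 0"
      by (simp add: inner_quat_def power2_eq_square)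
    then show "p = 0"
      by (simp add: quat_eq_iff add_nonneg_eq_0_iff)
  qed (simp add: inner_quat_def)
qed (simp_all add: norm_quat_def sgn_quat_def dist_quat_def uniformity_quat_def open_quat_def)

end

lemma norm_quat_power2: "(norm q)\<^sup>2 = (qRe q)\<^sup>2 + (qI q)\<^sup>2 + (qJ q)\<^sup>2 + (qK q)\<^sup>2"
  for q :: quat
  by (simp add: norm_quat_def inner_quat_def power2_eq_square)

instantiation quat :: real_normed_div_algebra
begin

definition "inverse q = Quat (qRe q) (- qI q) (- qJ q) (- qK q) /\<^sub>R (norm q)\<^sup>2" for q :: quat
definition "p div q = p * inverse q" for p q :: quat

instance
proof
  fix p q :: quat
  define c where "c = Quat (qRe p) (- qI p) (- qJ p) (- qK p)"
  define n where "n = (norm p)\<^sup>2"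
  have pc: "p * c = of_real n" "c * p = of_real n"
    by (simp_all only: n_def quat_eq_iff quat_times_sel quat_of_real_sel norm_quat_power2 c_def
          quat.sel)
      (simp_all add: power2_eq_square)
  have inv: "inverse p = inverse n *\<^sub>R c"
    by (simp add: inverse_quat_def c_def n_def)
  have unit: "p * inverse p = 1 \<and> inverse p * p = 1" if "p \<noteq> 0"
  proof -
    have "n \<noteq> 0"
      using that by (simp add: n_def)
    then show ?thesis
      by (simp add: inv pc scaleR_conv_of_real[of _ "of_real _"] flip: of_real_mult)
  qed
  show "p \<noteq> 0 \<Longrightarrow> inverse p * p = 1" "p \<noteq> 0 \<Longrightarrow> p * inverse p = 1"
    using unit by auto
  show "p div q = p * inverse q"
    by (simp add: divide_quat_def)
  show "inverse (0::quat) = 0"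
    by (simp add: inverse_quat_def quat_eq_iff)
  have "(norm (p * q))\<^sup>2 = (norm p * norm q)\<^sup>2"
    unfolding power_mult_distrib norm_quat_power2 quat_times_sel
    by (simp only: power2_eq_square) (simp add: algebra_simps)
  then show "norm (p * q) = norm p * norm q"
    by (metis mult_nonneg_nonneg norm_ge_zero power2_eq_iff_nonneg)
qed

end

instantiation quat :: euclidean_space
begin

definition "Basis = {Quat 1 0 0 0, Quat 0 1 0 0, Quat 0 0 1 0, Quat 0 0 0 1}"

instance
proof
  show "(Basis :: quat set) \<noteq> {}" "finite (Basis :: quat set)"
    by (simp_all add: Basis_quat_def)
  show "inner u v = (if u = v then 1 else 0)" if "u \<in> Basis" "v \<in> Basis" for u v :: quat
    using that unfolding Basis_quat_def
    by (elim insertE emptyE) (simp_all add: inner_quat_def)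
  show "(\<forall>u\<in>Basis. inner x u = 0) \<longleftrightarrow> x = 0" for x :: quat
    by (simp add: Basis_quat_def inner_quat_def) (simp add: quat_eq_iff)
qed

end


section \<open>Slices and slice regular functions\<close>

definition imag_units :: "quat set" where
  "imag_units = {q. q^2 = -1}"

text \<open>
  \<open>slice I\<close> is the identification \<open>x + iy \<mapsto> x + yI\<close> of the complex numbers with the plane
  \<open>L\<^sub>I\<close>. It restricts to the open unit disc, giving the disc \<open>B\<^sub>I\<close>, and intertwines
  complex and quaternionic conjugation.
\<close>

definition slice :: "quat \<Rightarrow> complex \<Rightarrow> quat" where
  "slice I z = of_real (Re z) + of_real (Im z) * I"

text \<open>
  Functions on the open unit ball are total functions of which only the values on \<open>ball 0 1\<close>
  matter. The partial derivatives of the restriction to a slice are the functions \<open>fx\<close>, \<open>fy\<close>.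
\<close>

definition slice_regular :: "(quat \<Rightarrow> quat) \<Rightarrow> bool" where
  "slice_regular f \<longleftrightarrow> (\<forall>I\<in>imag_units. \<exists>fx fy :: complex \<Rightarrow> quat.
     continuous_on (ball 0 1) fx \<and> continuous_on (ball 0 1) fy \<and>
     (\<forall>z\<in>ball 0 1.
        ((\<lambda>x. f (slice I (Complex x (Im z)))) has_vector_derivative fx z) (at (Re z)) \<and>
        ((\<lambda>y. f (slice I (Complex (Re z) y))) has_vector_derivative fy z) (at (Im z)) \<and>
        (1/2) *\<^sub>R (fx z + I * fy z) = 0))"

definition hardy2 :: "(quat \<Rightarrow> quat) set" where
  "hardy2 = {f. slice_regular f \<and>
     (\<exists>a :: nat \<Rightarrow> quat. (\<forall>q\<in>ball 0 1. (\<lambda>n. q ^ n * a n) sums f q) \<and>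
                        summable (\<lambda>n. (norm (a n))\<^sup>2))}"

definition hardy_inf :: "(quat \<Rightarrow> quat) set" where
  "hardy_inf = {f. slice_regular f \<and> bounded (f ` ball 0 1)}"


section \<open>Radial boundary values\<close>

text \<open>
  \<open>Lim\<close> is a total operator with an arbitrary value where there is no limit, so boundary values
  are only used together with \<open>radial_limit_exists\<close>.
\<close>

definition radial_limit_exists ::
  "('a::real_normed_vector \<Rightarrow> 'b::real_normed_vector) \<Rightarrow> 'a \<Rightarrow> bool" where
  "radial_limit_exists f q \<longleftrightarrow> (\<exists>l. ((\<lambda>r. f (r *\<^sub>R q)) \<longlongrightarrow> l) (at_left (1::real)))"

definition boundary_value ::
  "('a::real_normed_vector \<Rightarrow> 'b::real_normed_vector) \<Rightarrow> 'a \<Rightarrow> 'b" where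
  "boundary_value f q = Lim (at_left (1::real)) (\<lambda>r. f (r *\<^sub>R q))"


section \<open>The measure on the boundary of the ball\<close>

text \<open>The area element \<open>sin \<theta> d\<theta> d\<phi>\<close> of the 2-sphere of imaginary units.\<close>

definition area_imag_units :: "quat measure" where
  "area_imag_units =
     distr (density (restrict_space lborel ({0..pi} \<times> {0..<2*pi})) (\<lambda>(\<theta>, \<phi>). ennreal (sin \<theta>)))
       borel (\<lambda>(\<theta>, \<phi>). Quat 0 (sin \<theta> * cos \<phi>) (sin \<theta> * sin \<phi>) (cos \<theta>))"

text \<open>
  A Borel measure on all quaternions, carried by the unit sphere: the image of \<open>d\<sigma>(I) dt\<close> under
  \<open>(I, t) \<mapsto> exp (t I)\<close>, divided by its total mass \<open>4\<pi> \<cdot> 2\<pi>\<close>.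
\<close>

definition boundary_measure :: "quat measure" where
  "boundary_measure = scale_measure (ennreal (1 / (8 * pi\<^sup>2)))
     (distr (area_imag_units \<Otimes>\<^sub>M restrict_space lborel {0..<2*pi})
       borel (\<lambda>(I, t). of_real (cos t) + of_real (sin t) * I))"

lemma borel_measurable_Quat [measurable (raw)]:
  assumes [measurable]: "a \<in> borel_measurable M" "b \<in> borel_measurable M"
    "c \<in> borel_measurable M" "d \<in> borel_measurable M"
  shows "(\<lambda>x. Quat (a x) (b x) (c x) (d x)) \<in> borel_measurable M"
proof -
  have "(\<lambda>x. Quat (a x) (b x) (c x) (d x)) = (\<lambda>x. a x *\<^sub>R Quat 1 0 0 0 + b x *\<^sub>R Quat 0 1 0 0 +
      c x *\<^sub>R Quat 0 0 1 0 + d x *\<^sub>R Quat 0 0 0 1)"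
    by (simp add: quat_eq_iff fun_eq_iff)
  then show ?thesis
    by simp
qed

lemma norm_imag_unit:
  assumes "q \<in> imag_units"
  shows "norm q = 1"
proof -
  have "(norm q)\<^sup>2 = 1"
    using assms by (simp add: imag_units_def flip: norm_power)
  then show ?thesis
    by (simp add: power2_eq_1_iff) (use norm_ge_zero[of q] in linarith)
qed

lemma imag_units_iff: "q \<in> imag_units \<longleftrightarrow> qRe q = 0 \<and> norm q = 1"
proof
  assume q: "q \<in> imag_units"
  have n: "(norm q)\<^sup>2 = 1"
    using norm_imag_unit[OF q] by simp
  have "qRe (q * q) = - 1"
    using q by (simp add: imag_units_def power2_eq_square)
  with n[unfolded norm_quat_power2] have "qRe q * qRe q = 0"
    unfolding quat_times_sel power2_eq_square by linarith
  then show "qRe q = 0 \<and> norm q = 1"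
    using norm_imag_unit[OF q] by simp
next
  assume q: "qRe q = 0 \<and> norm q = 1"
  then have "(qI q)\<^sup>2 + (qJ q)\<^sup>2 + (qK q)\<^sup>2 = 1"
    using norm_quat_power2[of q] by simp
  with q show "q \<in> imag_units"
    by (simp add: imag_units_def quat_eq_iff power2_eq_square)
qed

lemma norm_slice:
  assumes "I \<in> imag_units"
  shows "norm (slice I z) = cmod z"
proof -
  have "qRe I = 0" "(qI I)\<^sup>2 + (qJ I)\<^sup>2 + (qK I)\<^sup>2 = 1"
    using assms norm_quat_power2[of I] by (simp_all add: imag_units_iff)
  moreover have "(norm (slice I z))\<^sup>2 = (Re z + Im z * qRe I)\<^sup>2
      + (Im z)\<^sup>2 * ((qI I)\<^sup>2 + (qJ I)\<^sup>2 + (qK I)\<^sup>2)"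
    by (simp add: slice_def norm_quat_power2 power_mult_distrib algebra_simps)
  ultimately have "(norm (slice I z))\<^sup>2 = (cmod z)\<^sup>2"
    by (simp add: cmod_power2)
  then show ?thesis
    by simp
qed

lemma emeasure_area_imag_units: "emeasure area_imag_units UNIV = ennreal (4 * pi)"
proof -
  let ?R = "{0..pi} \<times> {0..<2*pi}"
  have [measurable]: "?R \<in> sets (borel :: (real \<times> real) measure)"
    by (intro borel_Times) auto
  have sin_int: "(\<integral>\<^sup>+ x. ennreal (sin x) * indicator {0..pi} x \<partial>lborel) = ennreal 2"
  proof -
    have "(\<integral>\<^sup>+ x. ennreal (sin x) * indicator {0..pi} x \<partial>lborel) = ennreal (- cos pi - - cos 0)"
      by (rule nn_integral_FTC_Icc) (auto intro!: derivative_eq_intros sin_ge_zero)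
    then show ?thesis
      by simp
  qed
  let ?L = "restrict_space lborel ?R"
  have fst_snd [measurable]:
    "fst \<in> borel_measurable (borel :: (real \<times> real) measure)"
    "snd \<in> borel_measurable (borel :: (real \<times> real) measure)"
    by (intro borel_measurable_continuous_onI continuous_intros)+
  have dens: "(\<lambda>(\<theta>, \<phi>). ennreal (sin \<theta>)) \<in> borel_measurable ?L"
    unfolding split_beta by (intro measurable_restrict_space1) simp
  have "(\<lambda>(\<theta>, \<phi>). Quat 0 (sin \<theta> * cos \<phi>) (sin \<theta> * sin \<phi>) (cos \<theta>)) \<in> borel_measurable ?L"
    unfolding split_beta by (intro measurable_restrict_space1) simp
  then have "emeasure area_imag_units UNIV =
      emeasure (density ?L (\<lambda>(\<theta>, \<phi>). ennreal (sin \<theta>))) (space ?L)"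
    by (simp add: area_imag_units_def emeasure_distr)
  also have "\<dots> = (\<integral>\<^sup>+ x. (case x of (\<theta>, \<phi>) \<Rightarrow> ennreal (sin \<theta>)) \<partial>?L)"
    by (subst emeasure_density[OF dens]) (auto simp: sets_restrict_space intro!: nn_integral_cong)
  also have "\<dots> = (\<integral>\<^sup>+ x. (ennreal (sin (fst x)) * indicator {0..pi} (fst x))
      * indicator {0..<2*pi} (snd x) \<partial>(lborel \<Otimes>\<^sub>M lborel))"
    unfolding lborel_prod
    by (subst nn_integral_restrict_space)
      (auto intro!: nn_integral_cong split: split_indicator)
  also have "\<dots> = (\<integral>\<^sup>+ x. (\<integral>\<^sup>+ y. (ennreal (sin x) * indicator {0..pi} x)
      * indicator {0..<2*pi} y \<partial>lborel) \<partial>lborel)"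
    by (subst lborel.nn_integral_fst[symmetric]) simp_all
  also have "\<dots> = ennreal 2 * ennreal (2 * pi)"
    by (simp add: nn_integral_cmult nn_integral_multc sin_int)
  also have "\<dots> = ennreal (2 * (2 * pi))"
    by (rule ennreal_mult[symmetric]) simp_all
  also have "\<dots> = ennreal (4 * pi)"
    by simp
  finally show ?thesis .
qed

lemma emeasure_boundary_measure: "emeasure boundary_measure UNIV = 1"
proof -
  interpret sigma_finite_measure "restrict_space lborel {0..<2*pi}"
    by (rule sigma_finite_measure_restrict_space[OF lborel.sigma_finite_measure_axioms]) simp
  let ?M = "area_imag_units \<Otimes>\<^sub>M restrict_space lborel {0..<2*pi}"
  have [simp]: "space area_imag_units = UNIV" "sets area_imag_units = sets borel"
    by (simp_all add: area_imag_units_def)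
  have space: "space ?M = UNIV \<times> {0..<2*pi}"
    by (simp add: space_pair_measure space_restrict_space)
  have "(\<lambda>(I, t). of_real (cos t) + of_real (sin t) * I) \<in> borel_measurable ?M"
  proof -
    have [measurable]: "fst \<in> borel_measurable ?M"
      using measurable_fst[of area_imag_units "restrict_space lborel {0..<2*pi}"]
      by (simp cong: measurable_cong_sets)
    have "snd \<in> ?M \<rightarrow>\<^sub>M restrict_space lborel {0..<2*pi}"
      by (rule measurable_snd)
    then have [measurable]: "snd \<in> borel_measurable ?M"
      by (simp add: measurable_restrict_space2_iff)
    show ?thesis
      unfolding split_beta scaleR_conv_of_real[symmetric] of_real_def by measurable
  qed
  then have "emeasure boundary_measure UNIV =
      ennreal (1 / (8 * pi\<^sup>2)) * emeasure ?M (UNIV \<times> {0..<2*pi})"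
    by (simp add: boundary_measure_def emeasure_distr space)
  also have "emeasure ?M (UNIV \<times> {0..<2*pi}) = ennreal (4 * pi) * ennreal (2 * pi)"
    by (subst emeasure_pair_measure_Times)
      (auto simp: emeasure_area_imag_units sets_restrict_space emeasure_restrict_space)
  finally show ?thesis
    by (simp add: power2_eq_square flip: ennreal_mult)
qed

definition inner_function :: "(quat \<Rightarrow> quat) \<Rightarrow> bool" where
  "inner_function f \<longleftrightarrow> f \<in> hardy_inf \<and> (\<forall>q\<in>ball 0 1. norm (f q) \<le> 1) \<and>
     (AE q in boundary_measure. radial_limit_exists f q \<and> norm (boundary_value f q) = 1)"

end

theory Submission
  imports Defs "HOL-Real_Asymp.Real_Asymp"
begin

text \<open>
  Since \<open>f (x + yK) = b + K c\<close> with \<open>b\<close> and \<open>c\<close> independent of the imaginary unit \<open>K\<close>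
  (\<open>representation_formula\<close>), the boundary behaviour of \<open>f\<close> can be studied on one sphere
  \<open>{cos t + sin t K}\<close> at a time. If radial limits exist at two points of such a sphere, the limits of
  \<open>b\<close> and \<open>c\<close> exist, and with them all radial limits on the sphere. On the sphere
  \<open>\<bar>b + K c\<bar>\<^sup>2 = \<bar>b\<bar>\<^sup>2 + \<bar>c\<bar>\<^sup>2 + 2 \<langle>b c\<^sup>*, K\<rangle>\<close> is affine in \<open>K\<close>, so it equals \<open>1\<close> for almost every
  \<open>K\<close> only if it equals \<open>1\<close> for all \<open>K\<close>. Expressed through the values \<open>u + v J\<close> and
  \<open>u' + v' J\<close> at the two points of the sphere in \<open>L\<^sub>I\<close>, this means
  \<open>\<bar>u\<bar>\<^sup>2 + \<bar>v\<bar>\<^sup>2 = \<bar>u'\<bar>\<^sup>2 + \<bar>v'\<bar>\<^sup>2 = 1\<close> and \<open>u v' = u' v\<close> (\<open>norm_sphere_eq_1_iff\<close>). By Fubini's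
  theorem, \<open>\<bar>f\<bar> = 1\<close> almost everywhere on the boundary is therefore equivalent to the two conditions
  on \<open>F\<close> and \<open>G\<close> for almost every \<open>t\<close>. The existence of radial limits is part of both sides, so
  Fatou's theorem is not needed.

  It remains to see that these conditions imply \<open>\<bar>f\<bar> \<le> 1\<close> in the ball. A projection of \<open>f\<close>
  restricted to a slice reduces this to a complex power series with square summable coefficients
  whose radial limits have modulus at most \<open>1\<close> almost everywhere; Poisson's formula together with the
  boundedness of the square means on circles bounds it by \<open>1\<close> (\<open>cmod_le_1_of_radial_limits\<close>).
\<close>

section \<open>Quaternions and slices\<close>

text \<open>Quaternionic conjugation.\<close>

definition qcnj :: "quat \<Rightarrow> quat" where
  "qcnj q = Quat (qRe q) (- qI q) (- qJ q) (- qK q)"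

lemma qcnj_sel [simp]:
  "qRe (qcnj q) = qRe q" "qI (qcnj q) = - qI q" "qJ (qcnj q) = - qJ q" "qK (qcnj q) = - qK q"
  by (simp_all add: qcnj_def)

lemma qcnj_mult: "qcnj (p * q) = qcnj q * qcnj p"
  by (simp add: quat_eq_iff algebra_simps)

lemma qcnj_add: "qcnj (p + q) = qcnj p + qcnj q"
  and qcnj_qcnj: "qcnj (qcnj p) = p"
  by (simp_all add: quat_eq_iff)

lemma mult_qcnj: "p * qcnj p = of_real ((norm p)\<^sup>2)"
  by (simp only: quat_eq_iff quat_times_sel qcnj_sel quat_of_real_sel norm_quat_power2)
     (simp add: power2_eq_square)

lemma inner_mult_right_quat: "p \<bullet> (k * q) = (p * qcnj q) \<bullet> k"
  by (simp add: inner_quat_def algebra_simps)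

lemma qcnj_imag_unit: "I \<in> imag_units \<Longrightarrow> qcnj I = - I"
  by (simp add: quat_eq_iff imag_units_iff)

lemma imag_unit_square: "I \<in> imag_units \<Longrightarrow> I * I = -1"
  by (simp add: imag_units_def power2_eq_square)

lemma imag_unit_square_mult: "I \<in> imag_units \<Longrightarrow> I * (I * x) = - x"
  using imag_unit_square[of I] by (simp flip: mult.assoc)

lemma imag_unit_uminus: "I \<in> imag_units \<Longrightarrow> - I \<in> imag_units"
  by (simp add: imag_units_def)

lemma imag_units_anticommute:
  assumes "I \<in> imag_units" "J \<in> imag_units" "orthogonal J I"
  shows "J * I = - (I * J)"
  using assms by (simp add: quat_eq_iff imag_units_iff orthogonal_def inner_quat_def algebra_simps)

lemma slice_0 [simp]: "slice I 0 = 0"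
  and slice_1 [simp]: "slice I 1 = 1"
  and slice_i: "slice I \<i> = I"
  and slice_of_real: "slice I (of_real r) = of_real r"
  and slice_add: "slice I (z + w) = slice I z + slice I w"
  and slice_diff: "slice I (z - w) = slice I z - slice I w"
  and slice_uminus: "slice I (- z) = - slice I z"
  and slice_scaleR: "slice I (r *\<^sub>R z) = r *\<^sub>R slice I z"
  by (simp_all add: slice_def algebra_simps scaleR_conv_of_real)

lemma slice_mult:
  assumes "I \<in> imag_units"
  shows "slice I (z * w) = slice I z * slice I w"
proof -
  have "slice I z * slice I w = of_real (Re z * Re w) + of_real (Im z * Im w) * (I * I)
      + of_real (Re z * Im w + Im z * Re w) * I"
    by (simp add: slice_def of_real_def algebra_simps)
  then show ?thesis
    using assms by (simp add: imag_unit_square slice_def algebra_simps)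
qed

lemma slice_power: "I \<in> imag_units \<Longrightarrow> slice I (z ^ n) = slice I z ^ n"
  by (induction n) (simp_all add: slice_mult)

lemma qcnj_slice: "I \<in> imag_units \<Longrightarrow> qcnj (slice I z) = slice I (cnj z)"
  by (simp add: slice_def quat_eq_iff imag_units_iff of_real_def)

lemma slice_anticommute:
  assumes "I \<in> imag_units" "J \<in> imag_units" "orthogonal J I"
  shows "J * slice I z = slice I (cnj z) * J"
  using imag_units_anticommute[OF assms]
  by (simp add: slice_def of_real_def algebra_simps)

text \<open>
  The orthogonal projection of the quaternions onto the plane \<open>L\<^sub>I\<close>, read as a complex number.
  It is \<open>L\<^sub>I\<close>-linear for multiplication from the left, so it turns power series
  \<open>\<Sum>q\<^sup>n a\<^sub>n\<close> with coefficients on the right into complex power series. If \<open>J\<close> is orthogonal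
  to \<open>I\<close>, the second component of \<open>u + v J\<close> is found by projecting \<open>(u + v J) (- J)\<close>.
\<close>

definition slice_proj :: "quat \<Rightarrow> quat \<Rightarrow> complex" where
  "slice_proj I q = Complex (qRe q) (q \<bullet> I)"

lemma slice_proj_slice:
  assumes "I \<in> imag_units"
  shows "slice_proj I (slice I z) = z"
proof -
  have "I \<bullet> I = 1" using assms by (simp add: norm_imag_unit dot_square_norm)
  moreover have "1 \<bullet> I = 0" using assms by (simp add: imag_units_iff inner_quat_def)
  ultimately show ?thesis
    using assms by (simp add: slice_proj_def slice_def of_real_def inner_add_left complex_eq_iff imag_units_iff)
qed

lemma slice_proj_add: "slice_proj I (p + q) = slice_proj I p + slice_proj I q"
  by (simp add: slice_proj_def inner_add_left complex_eq_iff)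

lemma slice_proj_mult:
  assumes "I \<in> imag_units"
  shows "slice_proj I (slice I z * q) = z * slice_proj I q"
proof -
  have "(I * q) \<bullet> I = qRe q" "qRe (I * q) = - (q \<bullet> I)"
  proof -
    have "(I * q) \<bullet> I = qRe q * (I \<bullet> I)"
      using assms by (simp add: inner_quat_def imag_units_iff algebra_simps)
    then show "(I * q) \<bullet> I = qRe q"
      using assms by (simp add: norm_imag_unit dot_square_norm)
    show "qRe (I * q) = - (q \<bullet> I)"
      using assms by (simp add: inner_quat_def imag_units_iff algebra_simps)
  qed
  then show ?thesis
    by (simp add: slice_proj_def slice_def of_real_def distrib_right complex_eq_iff inner_add_left algebra_simps
        del: quat_times_sel)
qed

lemma bounded_linear_slice_proj: "bounded_linear (slice_proj I)"
proof -
  have "bounded_linear (\<lambda>q. of_real (q \<bullet> 1) + \<i> * of_real (q \<bullet> I))"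
    by (intro bounded_linear_add bounded_linear_const_mult
        bounded_linear_compose[OF bounded_linear_of_real] bounded_linear_inner_left)
  moreover have "slice_proj I = (\<lambda>q. of_real (q \<bullet> 1) + \<i> * of_real (q \<bullet> I))"
    by (simp add: fun_eq_iff slice_proj_def complex_eq_iff inner_quat_def)
  ultimately show ?thesis by simp
qed

lemma norm_slice_proj_le:
  assumes "I \<in> imag_units"
  shows "cmod (slice_proj I q) \<le> norm q"
proof -
  define z where "z = slice_proj I q"
  have "slice_proj I (slice I (cnj z) * q) = cnj z * z"
    using assms by (simp add: slice_proj_mult z_def)
  then have "Re (slice_proj I (slice I (cnj z) * q)) = (cmod z)\<^sup>2"
    by (simp only: cmod_power2) (simp add: power2_eq_square)
  then have "qRe (slice I (cnj z) * q) = (cmod z)\<^sup>2"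
    by (simp only: slice_proj_def complex.sel)
  moreover have "qRe p \<le> norm p" for p :: quat
    using Cauchy_Schwarz_ineq2[of p 1] by (simp add: inner_quat_def)
  ultimately have "(cmod z)\<^sup>2 \<le> cmod z * norm q"
    using assms by (metis norm_mult norm_slice complex_mod_cnj)
  then show ?thesis
    by (cases "z = 0") (auto simp: power2_eq_square z_def[symmetric])
qed

lemma slice_proj_slice_mult:
  assumes "I \<in> imag_units" "J \<in> imag_units" "orthogonal J I"
  shows "slice_proj I (slice I u + slice I v * J) = u"
    and "slice_proj I ((slice I u + slice I v * J) * - J) = v"
proof -
  have J: "slice_proj I J = 0"
    using assms by (simp add: slice_proj_def imag_units_iff orthogonal_def complex_eq_iff)
  show "slice_proj I (slice I u + slice I v * J) = u"
    using assms by (simp add: slice_proj_add slice_proj_slice slice_proj_mult J)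
  have "(slice I u + slice I v * J) * - J = slice I (- u) * J + slice I v"
    using assms by (simp add: distrib_right mult.assoc imag_unit_square slice_uminus)
  then show "slice_proj I ((slice I u + slice I v * J) * - J) = v"
    using assms by (simp add: slice_proj_add slice_proj_slice slice_proj_mult J)
qed

lemma slice_add_mult_mult_qcnj:
  assumes "I \<in> imag_units" "J \<in> imag_units" "orthogonal J I"
  shows "(slice I u + slice I v * J) * qcnj (slice I u' + slice I v' * J)
    = slice I (u * cnj u' + v * cnj v') + slice I (v * u' - u * v') * J"
proof -
  have "qcnj (slice I u' + slice I v' * J) = slice I (cnj u') - slice I v' * J"
    using assms by (simp add: qcnj_add qcnj_mult qcnj_slice qcnj_imag_unit slice_anticommute)
  moreover have "slice I v * (J * slice I (cnj u')) = slice I (v * u') * J"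
    using assms by (simp add: slice_anticommute slice_mult mult.assoc)
  moreover have "slice I v * (J * (slice I v' * J)) = - slice I (v * cnj v')"
  proof -
    have "J * (slice I v' * J) = slice I (cnj v') * (J * J)"
      using slice_anticommute[OF assms, of v'] by (metis mult.assoc)
    then show ?thesis using assms by (simp add: imag_unit_square slice_mult)
  qed
  moreover have "slice I u * (slice I v' * J) = slice I (u * v') * J"
    using assms by (simp add: slice_mult mult.assoc)
  moreover have "slice I u * slice I (cnj u') = slice I (u * cnj u')"
    using assms by (simp add: slice_mult)
  ultimately show ?thesis
    by (simp add: slice_add slice_diff distrib_right right_diff_distrib left_diff_distrib mult.assoc)
qed

lemma norm_slice_add_mult:
  assumes "I \<in> imag_units" "J \<in> imag_units" "orthogonal J I"
  shows "(norm (slice I u + slice I v * J))\<^sup>2 = (cmod u)\<^sup>2 + (cmod v)\<^sup>2"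
proof -
  have "of_real ((norm (slice I u + slice I v * J))\<^sup>2) = slice I (u * cnj u + v * cnj v)"
    unfolding mult_qcnj[symmetric] using slice_add_mult_mult_qcnj[OF assms, of u v u v]
    by (simp add: mult.commute)
  also have "u * cnj u + v * cnj v = of_real ((cmod u)\<^sup>2 + (cmod v)\<^sup>2)"
    by (simp only: complex_norm_square of_real_add)
  finally show ?thesis
    unfolding slice_of_real of_real_eq_iff .
qed

lemma norm_add_mult_imag_unit:
  "(norm (b + K * c))\<^sup>2 = (norm b)\<^sup>2 + (norm c)\<^sup>2 + 2 * ((b * qcnj c) \<bullet> K)"
  if "K \<in> imag_units" for b c K :: quat
proof -
  have "norm (K * c) = norm c"
    using that by (simp add: norm_mult norm_imag_unit)
  then have "(K * c) \<bullet> (K * c) = c \<bullet> c"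
    by (simp add: dot_square_norm)
  then show ?thesis
    unfolding power2_norm_eq_inner inner_mult_right_quat[symmetric]
    by (simp add: inner_add_left inner_add_right inner_commute)
qed

text \<open>
  The algebra behind the two boundary conditions. The map \<open>K \<mapsto> \<bar>b + K c\<bar>\<^sup>2\<close> is affine in \<open>K\<close>
  with linear part given by the vector part of \<open>b c\<^sup>*\<close>. With \<open>p = b + I c = u + v J\<close> and
  \<open>q = b - I c = u' + v' J\<close> of equal norm, \<open>4 b c\<^sup>* = (q p\<^sup>* - p q\<^sup>*) I\<close>, and its vector part
  is determined by the \<open>J\<close>-component \<open>v u' - u v'\<close> of \<open>p q\<^sup>*\<close>.
\<close>

lemma norm_sphere_eq_1_iff:
  assumes IJ: "I \<in> imag_units" "J \<in> imag_units" "orthogonal J I"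
    and p: "b + I * c = slice I u + slice I v * J"
    and q: "b - I * c = slice I u' + slice I v' * J"
  shows "(\<forall>K\<in>imag_units. norm (b + K * c) = 1) \<longleftrightarrow>
    (cmod u)\<^sup>2 + (cmod v)\<^sup>2 = 1 \<and> (cmod u')\<^sup>2 + (cmod v')\<^sup>2 = 1 \<and> u * v' = u' * v"
proof -
  define p where "p = b + I * c"
  define q where "q = b - I * c"
  define B where "B = v * u' - u * v'"
  have np: "(norm p)\<^sup>2 = (cmod u)\<^sup>2 + (cmod v)\<^sup>2" and nq: "(norm q)\<^sup>2 = (cmod u')\<^sup>2 + (cmod v')\<^sup>2"
    unfolding p_def q_def assms(4,5) by (rule norm_slice_add_mult[OF IJ])+
  have b: "b = (1/2) *\<^sub>R (p + q)"
    by (simp add: p_def q_def flip: scaleR_2)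
  have c: "c = - (1/2) *\<^sub>R (I * (p - q))"
  proof -
    have "p - q = 2 *\<^sub>R (I * c)" by (simp add: p_def q_def scaleR_2)
    then show ?thesis using IJ by (simp add: imag_unit_square_mult)
  qed
  have bc: "\<exists>s. b * qcnj c = of_real s + (1/2) *\<^sub>R (slice I (\<i> * B) * J)"
    if eq: "norm p = norm q"
  proof -
    define A where "A = u * cnj u' + v * cnj v'"
    have pq: "p * qcnj q = slice I A + slice I B * J"
      unfolding p_def q_def assms(4,5) slice_add_mult_mult_qcnj[OF IJ] A_def B_def ..
    have qp: "q * qcnj p = slice I (cnj A) - slice I B * J"
    proof -
      have "q * qcnj p = qcnj (p * qcnj q)"
        by (simp add: qcnj_mult qcnj_qcnj)
      also have "\<dots> = slice I (cnj A) - J * slice I (cnj B)"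
        unfolding pq using IJ by (simp add: qcnj_add qcnj_mult qcnj_slice qcnj_imag_unit)
      finally show ?thesis using slice_anticommute[OF IJ, of "cnj B"] by simp
    qed
    have "qcnj c = (1/2) *\<^sub>R ((qcnj p - qcnj q) * I)"
      unfolding c using IJ
      by (simp add: quat_eq_iff imag_units_iff algebra_simps)
    then have "b * qcnj c = (1/4) *\<^sub>R (((p + q) * (qcnj p - qcnj q)) * I)"
      unfolding b by (simp add: mult.assoc)
    also have "(p + q) * (qcnj p - qcnj q) = q * qcnj p - p * qcnj q"
      using eq by (simp add: algebra_simps mult_qcnj)
    also have "\<dots> = slice I (cnj A - A) - 2 *\<^sub>R (slice I B * J)"
      unfolding pq qp by (simp add: slice_diff algebra_simps scaleR_2)
    also have "cnj A - A = of_real (- 2 * Im A) * \<i>"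
      by (simp add: complex_eq_iff)
    also have "(slice I (of_real (- 2 * Im A) * \<i>) - 2 *\<^sub>R (slice I B * J)) * I
        = of_real (2 * Im A) + 2 *\<^sub>R (slice I (\<i> * B) * J)"
    proof -
      have "slice I (of_real (- 2 * Im A) * \<i>) * I = of_real (- 2 * Im A) * (I * I)"
        using IJ(1) by (simp only: slice_mult slice_of_real slice_i mult.assoc)
      then have "slice I (of_real (- 2 * Im A) * \<i>) * I = of_real (2 * Im A)"
        using IJ(1) by (simp add: imag_unit_square)
      moreover have "slice I B * J * I = - (slice I (\<i> * B) * J)"
      proof -
        have "slice I B * J * I = - (slice I B * I * J)"
          using imag_units_anticommute[OF IJ] by (simp add: mult.assoc)
        also have "slice I B * I = slice I (B * \<i>)"
          using IJ(1) by (simp add: slice_mult slice_i)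
        finally show ?thesis by (simp add: mult.commute)
      qed
      ultimately show ?thesis by (simp add: left_diff_distrib)
    qed
    finally have "b * qcnj c = of_real (Im A / 2) + (1/2) *\<^sub>R (slice I (\<i> * B) * J)"
      by (simp only: scaleR_add_right scaleR_scaleR of_real_def) simp
    then show ?thesis by blast
  qed
  have inner_real: "of_real s \<bullet> K = 0" if "K \<in> imag_units" for s and K :: quat
    using that by (simp add: inner_quat_def imag_units_iff)
  show ?thesis
  proof
    assume *: "\<forall>K\<in>imag_units. norm (b + K * c) = 1"
    then have 1: "norm p = 1" "norm q = 1"
      using IJ(1) imag_unit_uminus[OF IJ(1)] unfolding p_def q_def by (blast, force)
    define w where "w = b * qcnj c"
    have w0: "w \<bullet> K = 0" if "K \<in> imag_units" for K
    proof -
      have "(norm (b + K * c))\<^sup>2 = 1" "(norm (b + (- K) * c))\<^sup>2 = 1"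
        using * that imag_unit_uminus[OF that] by (simp_all del: mult_minus_left)
      then show ?thesis
        unfolding norm_add_mult_imag_unit[OF that] norm_add_mult_imag_unit[OF imag_unit_uminus[OF that]]
        by (simp add: w_def)
    qed
    obtain s where s: "w = of_real s + (1/2) *\<^sub>R (slice I (\<i> * B) * J)"
      using bc 1 by (auto simp: w_def)
    have "w \<bullet> Quat 0 1 0 0 = 0" "w \<bullet> Quat 0 0 1 0 = 0" "w \<bullet> Quat 0 0 0 1 = 0"
      by (rule w0; simp add: imag_units_iff norm_quat_def inner_quat_def)+
    then have "w = of_real (qRe w)"
      by (simp add: inner_quat_def quat_eq_iff)
    then have "(1/2) *\<^sub>R (slice I (\<i> * B) * J) = of_real (qRe w - s)"
      using s by (simp add: algebra_simps)
    then have "slice I (\<i> * B) * J = 2 *\<^sub>R of_real (qRe w - s)"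
      by (metis (no_types) scaleR_half_double scaleR_2 scaleR_add_right)
    then have "slice I 0 + slice I (\<i> * B) * J = slice I (of_real (2 * (qRe w - s))) + slice I 0 * J"
      unfolding slice_of_real by (simp add: scaleR_conv_of_real)
    then have "\<i> * B = 0"
      by (metis slice_proj_slice_mult(2)[OF IJ])
    then have "B = 0"
      by simp
    then show "(cmod u)\<^sup>2 + (cmod v)\<^sup>2 = 1 \<and> (cmod u')\<^sup>2 + (cmod v')\<^sup>2 = 1 \<and> u * v' = u' * v"
      using np nq 1 by (simp add: B_def mult.commute)
  next
    assume *: "(cmod u)\<^sup>2 + (cmod v)\<^sup>2 = 1 \<and> (cmod u')\<^sup>2 + (cmod v')\<^sup>2 = 1 \<and> u * v' = u' * v"
    then have 1: "norm p = 1" "norm q = 1"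
      using np nq by (simp_all add: power2_eq_1_iff) (metis norm_ge_zero not_one_le_zero neg_0_le_iff_le)+
    have "B = 0" using * by (simp add: B_def mult.commute)
    then obtain s where s: "b * qcnj c = of_real s"
      using bc 1 by auto
    show "\<forall>K\<in>imag_units. norm (b + K * c) = 1"
    proof
      fix K :: quat assume K: "K \<in> imag_units"
      have "(norm (b + K * c))\<^sup>2 = (norm (b + I * c))\<^sup>2"
        unfolding norm_add_mult_imag_unit[OF K] norm_add_mult_imag_unit[OF IJ(1)] s
        using K IJ(1) by (simp add: inner_real)
      then show "norm (b + K * c) = 1"
        using 1 by (simp add: p_def)
    qed
  qed
qed


section \<open>A maximum principle in the Hardy space of the disc\<close>

lemma has_integral_cis_int:
  "((\<lambda>t. cis (of_int k * t)) has_integral (if k = 0 then 2 * of_real pi else 0)) {0..2 * pi}"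
proof (cases "k = 0")
  case True
  then show ?thesis
    using has_integral_const_real[of "1::complex" 0 "2 * pi"] by (simp add: scaleR_conv_of_real)
next
  case False
  have "((\<lambda>t. cis (of_int k * t) / (\<i> * of_int k)) has_vector_derivative cis (of_int k * t)) (at t within {0..2 * pi})" for t
  proof -
    have "((\<lambda>z. exp (\<i> * of_int k * z) / (\<i> * of_int k)) has_field_derivative exp (\<i> * of_int k * z)) (at z)" for z
      using False by (auto intro!: derivative_eq_intros)
    from has_vector_derivative_real_field[OF this, of "of_real t" "{0..2*pi}"]
    show ?thesis by (simp add: cis_conv_exp mult.assoc)
  qed
  then have "((\<lambda>t. cis (of_int k * t)) has_integral
      (cis (of_int k * (2 * pi)) / (\<i> * of_int k) - cis (of_int k * 0) / (\<i> * of_int k))) {0..2 * pi}"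
    by (intro fundamental_theorem_of_calculus) auto
  moreover have "cis (of_int k * (2 * pi)) = 1"
    by (metis cis_multiple_2pi Ints_of_int mult.commute)
  ultimately show ?thesis using False by simp
qed

lemma has_integral_trigonometric_polynomial:
  fixes a :: "nat \<Rightarrow> complex"
  shows "((\<lambda>t. (cmod (\<Sum>n<N. a n * cis t ^ n))\<^sup>2) has_integral (2 * pi * (\<Sum>n<N. (cmod (a n))\<^sup>2))) {0..2 * pi}"
proof -
  have eq: "of_real ((cmod (\<Sum>n<N. a n * cis t ^ n))\<^sup>2)
      = (\<Sum>n<N. \<Sum>m<N. (a n * cnj (a m)) * cis (of_int (int n - int m) * t))" for t
  proof -
    have "cis t ^ n * cnj (cis t ^ m) = cis (of_int (int n - int m) * t)" for n m
    proof -
      have "real n * t + - (real m * t) = of_int (int n - int m) * t"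
        by (simp add: algebra_simps)
      then show ?thesis
        by (simp only: complex_cnj_power cis_cnj Complex.DeMoivre cis_mult mult_minus_right)
    qed
    then show ?thesis
      unfolding complex_norm_square cnj_sum sum_product
      by (intro sum.cong refl) (simp add: mult_ac)
  qed
  have "((\<lambda>t. \<Sum>n<N. \<Sum>m<N. (a n * cnj (a m)) * cis (of_int (int n - int m) * t)) has_integral
      (\<Sum>n<N. \<Sum>m<N. (a n * cnj (a m)) * (if int n - int m = 0 then 2 * of_real pi else 0))) {0..2 * pi}"
    by (intro has_integral_sum finite_lessThan has_integral_mult_right has_integral_cis_int)
  also have "(\<Sum>n<N. \<Sum>m<N. (a n * cnj (a m)) * (if int n - int m = 0 then 2 * of_real pi else 0))
      = (\<Sum>n<N. \<Sum>m<N. if n = m then (a n * cnj (a m)) * (2 * of_real pi) else 0)"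
    by (intro sum.cong refl) auto
  also have "\<dots> = of_real (2 * pi * (\<Sum>n<N. (cmod (a n))\<^sup>2))"
    by (simp add: sum_distrib_left complex_norm_square[symmetric] mult_ac del: of_real_power)
  finally have "((\<lambda>t. of_real ((cmod (\<Sum>n<N. a n * cis t ^ n))\<^sup>2)) has_integral
      (complex_of_real (2 * pi * (\<Sum>n<N. (cmod (a n))\<^sup>2)))) {0..2 * pi}"
    unfolding eq .
  from has_integral_linear[OF this bounded_linear_Re]
  show ?thesis by (simp only: o_def Re_complex_of_real)
qed

text \<open>The square means of a function in the Hardy space \<open>H\<^sup>2\<close> of the disc over circles stay bounded.\<close>

lemma integral_cmod_power2_circle_le:
  fixes a :: "nat \<Rightarrow> complex"
  assumes h: "\<And>z. z \<in> ball 0 1 \<Longrightarrow> (\<lambda>n. a n * z ^ n) sums h z"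
    and sq: "summable (\<lambda>n. (cmod (a n))\<^sup>2)" and r: "0 \<le> r" "r < 1"
  shows "integral {0..2 * pi} (\<lambda>t. (cmod (h (of_real r * cis t)))\<^sup>2) \<le> 2 * pi * (\<Sum>n. (cmod (a n))\<^sup>2)"
proof -
  define S where "S = (\<lambda>N t. \<Sum>n<N. (a n * of_real r ^ n) * cis t ^ n)"
  define C where "C = (\<Sum>n. norm (a n * of_real r ^ n))"
  have hS: "(\<lambda>N. S N t) \<longlonglongrightarrow> h (of_real r * cis t)" for t
    using h[of "of_real r * cis t"] r
    by (simp add: S_def sums_def norm_mult power_mult_distrib mult.assoc)
  have "summable (\<lambda>n. norm (a n * of_real r ^ n))"
  proof (rule powser_insidea)
    show "summable (\<lambda>n. a n * of_real ((1 + r) / 2) ^ n)"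
      using r by (intro sums_summable[OF h]) (simp add: norm_divide del: of_real_divide of_real_add)
  qed (use r in \<open>simp del: of_real_divide of_real_add\<close>)
  then have bound: "norm (S N t) \<le> C" for N t
    unfolding S_def C_def
    by (intro order.trans[OF norm_sum] order.trans[OF _ sum_le_suminf]) (auto simp: norm_mult norm_power)
  have int: "((\<lambda>t. (cmod (S N t))\<^sup>2) has_integral (2 * pi * (\<Sum>n<N. (cmod (a n * of_real r ^ n))\<^sup>2))) {0..2 * pi}" for N
    unfolding S_def by (rule has_integral_trigonometric_polynomial)
  have "(\<lambda>N. integral {0..2 * pi} (\<lambda>t. (cmod (S N t))\<^sup>2)) \<longlonglongrightarrow>
      integral {0..2 * pi} (\<lambda>t. (cmod (h (of_real r * cis t)))\<^sup>2)"
  proof (rule dominated_convergence(2)[where h = "\<lambda>_. C\<^sup>2"])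
    show "(\<lambda>t. (cmod (S N t))\<^sup>2) integrable_on {0..2 * pi}" for N
      using int by blast
    show "norm ((cmod (S N t))\<^sup>2) \<le> C\<^sup>2" for N t
      using bound[of N t] by (simp add: power_mono)
  qed (auto intro!: tendsto_intros hS)
  moreover have "integral {0..2 * pi} (\<lambda>t. (cmod (S N t))\<^sup>2) \<le> 2 * pi * (\<Sum>n. (cmod (a n))\<^sup>2)" for N
  proof -
    have "(\<Sum>n<N. (cmod (a n * of_real r ^ n))\<^sup>2) \<le> (\<Sum>n<N. (cmod (a n))\<^sup>2)"
      using r by (intro sum_mono power_mono) (auto simp: norm_mult norm_power power_le_one mult_left_le)
    also have "\<dots> \<le> (\<Sum>n. (cmod (a n))\<^sup>2)"
      by (intro sum_le_suminf sq) auto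
    finally show ?thesis
      using integral_unique[OF int, of N] by simp
  qed
  ultimately show ?thesis
    using LIMSEQ_le_const2 by blast
qed

text \<open>The Poisson kernel of the unit disc for the point \<open>w\<close>, without the normalising factor \<open>1/(2\<pi>)\<close>.\<close>

definition poisson_kernel :: "complex \<Rightarrow> real \<Rightarrow> real" where
  "poisson_kernel w t = (1 - (cmod w)\<^sup>2) / (cmod (cis t - w))\<^sup>2"

lemma cis_minus_nonzero: "cmod w < 1 \<Longrightarrow> cis t - w \<noteq> 0"
  using norm_cis[of t] by (metis eq_iff_diff_eq_0 less_irrefl)

lemma poisson_kernel_nonneg: "cmod w < 1 \<Longrightarrow> 0 \<le> poisson_kernel w t"
  by (simp add: poisson_kernel_def power_le_one)

lemma poisson_kernel_le:
  assumes "cmod w < 1"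
  shows "poisson_kernel w t \<le> 1 / (1 - cmod w)\<^sup>2"
proof -
  have "1 - cmod w \<le> cmod (cis t - w)"
    using norm_triangle_ineq2[of "cis t" w] by simp
  then have "(1 - cmod w)\<^sup>2 \<le> (cmod (cis t - w))\<^sup>2"
    using assms by (intro power_mono) auto
  then show ?thesis
    unfolding poisson_kernel_def using assms by (intro frac_le) (auto simp: power_le_one)
qed

lemma continuous_on_poisson_kernel: "cmod w < 1 \<Longrightarrow> continuous_on S (poisson_kernel w)"
  unfolding poisson_kernel_def[abs_def]
  using cis_minus_nonzero[of w] by (intro continuous_intros ballI) simp

text \<open>
  Poisson's formula for holomorphic functions is Cauchy's formula at \<open>w\<close> for the product of \<open>h\<close>
  with \<open>(1 - \<bar>w\<bar>\<^sup>2) / (1 - cnj w u)\<close>, a factor that equals \<open>1\<close> at \<open>u = w\<close> and turns the Cauchy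
  kernel into the Poisson kernel on the circle.
\<close>

lemma has_integral_poisson_kernel_mult:
  assumes h: "h holomorphic_on cball 0 1" and w: "cmod w < 1"
  shows "((\<lambda>t. h (cis t) * of_real (poisson_kernel w t)) has_integral (2 * of_real pi * h w)) {0..2 * pi}"
proof -
  define k where "k = (\<lambda>u. (1 - cnj w * w) / (1 - cnj w * u))"
  have nz: "1 - cnj w * u \<noteq> 0" if "cmod u \<le> 1" for u
  proof -
    have "cmod w * cmod u \<le> cmod w"
      using that by (intro mult_left_le) auto
    then have "cmod (cnj w * u) < 1"
      using w by (simp add: norm_mult)
    then show ?thesis by force
  qed
  have "(\<lambda>u. h u * k u) holomorphic_on cball 0 1"
    unfolding k_def using nz by (intro holomorphic_intros h) auto
  from Cauchy_integral_circlepath_simple[OF this, of w] w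
  have "((\<lambda>u. h u * k u / (u - w)) has_contour_integral (2 * of_real pi * \<i> * (h w * k w))) (part_circlepath 0 1 0 (2 * pi))"
    by (simp add: circlepath_def)
  then have "((\<lambda>t. (h (cis t) * k (cis t) / (cis t - w)) * \<i> * cis t) has_integral (2 * of_real pi * \<i> * (h w * k w))) {0..2 * pi}"
    by (subst (asm) has_contour_integral_part_circlepath_iff) simp_all
  then have "((\<lambda>t. ((h (cis t) * k (cis t) / (cis t - w)) * \<i> * cis t) * (- \<i>)) has_integral (2 * of_real pi * \<i> * (h w * k w)) * (- \<i>)) {0..2 * pi}"
    by (rule has_integral_mult_left)
  moreover have "((h (cis t) * k (cis t) / (cis t - w)) * \<i> * cis t) * (- \<i>) = h (cis t) * of_real (poisson_kernel w t)" for t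
  proof -
    have cis_cnj: "cis t * cnj (cis t - w) = 1 - cnj w * cis t"
      by (simp add: algebra_simps flip: cis_cnj) (simp add: cis_mult cis_cnj)
    have "(cis t - w) * (1 - cnj w * cis t) = of_real ((cmod (cis t - w))\<^sup>2) * cis t"
      unfolding complex_norm_square cis_cnj[symmetric] by (simp only: mult_ac)
    then have "k (cis t) / (cis t - w) * cis t = (1 - cnj w * w) * cis t / (of_real ((cmod (cis t - w))\<^sup>2) * cis t)"
      unfolding k_def by (simp add: mult.commute)
    also have "\<dots> = (1 - cnj w * w) / of_real ((cmod (cis t - w))\<^sup>2)"
      by simp
    also have "1 - cnj w * w = of_real (1 - (cmod w)\<^sup>2)"
      by (simp only: of_real_diff complex_norm_square of_real_1 mult.commute)
    finally have "k (cis t) / (cis t - w) * cis t = of_real (poisson_kernel w t)"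
      by (simp add: poisson_kernel_def)
    moreover have "((h (cis t) * k (cis t) / (cis t - w)) * \<i> * cis t) * (- \<i>) = h (cis t) * (k (cis t) / (cis t - w) * cis t)"
      by (simp add: algebra_simps)
    ultimately show ?thesis by simp
  qed
  moreover have "(2 * of_real pi * \<i> * (h w * k w)) * (- \<i>) = 2 * of_real pi * h w"
  proof -
    have "k w = 1" using nz[of w] w by (simp add: k_def)
    then show ?thesis by (simp add: algebra_simps)
  qed
  ultimately show ?thesis by (simp only:)
qed

lemma has_integral_poisson_kernel:
  assumes "cmod w < 1"
  shows "(poisson_kernel w has_integral (2 * pi)) {0..2 * pi}"
proof -
  have "((\<lambda>t. of_real (poisson_kernel w t)) has_integral complex_of_real (2 * pi)) {0..2 * pi}"
    using has_integral_poisson_kernel_mult[OF _ assms, of "\<lambda>_. 1"] by simp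
  from has_integral_linear[OF this bounded_linear_Re]
  show ?thesis by (simp only: o_def Re_complex_of_real)
qed

lemma AE_lborel_negligible:
  assumes "AE t in lborel. P t"
  obtains N where "negligible N" "\<And>t. t \<notin> N \<Longrightarrow> P t"
proof -
  obtain N where "N \<in> null_sets lborel" "\<And>t. t \<in> space lborel - N \<Longrightarrow> P t"
    using AE_E3[OF assms] by blast
  then show thesis
    using that[of N] by (simp add: negligible_iff_null_sets null_sets_completionI)
qed

text \<open>
  A maximum principle for \<open>H\<^sup>2\<close>: radial limits of modulus at most \<open>1\<close> almost everywhere bound the
  function by \<open>1\<close> in the disc. Poisson's formula is applied to \<open>h\<close> on circles of radius \<open>r < 1\<close>, and
  \<open>r\<close> tends to \<open>1\<close>. The limit under the integral is justified by
  \<open>x \<le> max 1 (min x M) + x\<^sup>2 / M\<close>: the first summand converges boundedly to \<open>1\<close>, and the integral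
  of the second is \<open>O(1/M)\<close> by the bound on square means.
\<close>

lemma cmod_le_1_of_radial_limits:
  fixes a :: "nat \<Rightarrow> complex"
  assumes h: "\<And>z. z \<in> ball 0 1 \<Longrightarrow> (\<lambda>n. a n * z ^ n) sums h z"
    and sq: "summable (\<lambda>n. (cmod (a n))\<^sup>2)"
    and lim: "AE t in lborel. t \<in> {0..<2 * pi} \<longrightarrow>
      (\<exists>l. ((\<lambda>r. h (r *\<^sub>R cis t)) \<longlongrightarrow> l) (at_left 1) \<and> cmod l \<le> 1)"
    and w: "cmod w < 1"
  shows "cmod (h w) \<le> 1"
proof -
  obtain N where N: "negligible N" "\<And>t. t \<notin> N \<Longrightarrow> t \<in> {0..<2 * pi} \<longrightarrow>
      (\<exists>l. ((\<lambda>r. h (r *\<^sub>R cis t)) \<longlongrightarrow> l) (at_left 1) \<and> cmod l \<le> 1)"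
    using AE_lborel_negligible[OF lim] by blast
  define C where "C = (1 / (1 - cmod w)\<^sup>2) * (2 * pi * (\<Sum>n. (cmod (a n))\<^sup>2))"
  have hol: "h holomorphic_on ball 0 1"
    by (rule power_series_holomorphic[of 0 1 a]) (simp add: h)
  define r where "r = (\<lambda>n::nat. 1 - 1 / (real n + 2))"
  have r: "0 \<le> r n" "r n < 1" for n
    by (auto simp: r_def divide_simps)
  have r_lim: "r \<longlonglongrightarrow> 1"
    unfolding r_def by real_asymp
  then have r_at: "filterlim r (at_left 1) sequentially"
    using r by (intro filterlim_at_withinI) auto
  define H where "H = (\<lambda>n t. cmod (h (of_real (r n) * cis t)))"
  let ?P = "poisson_kernel w"
  have cont_H: "continuous_on {0..2 * pi} (H n)" for n
    unfolding H_def
    by (intro continuous_intros continuous_on_compose2[OF holomorphic_on_imp_continuous_on[OF hol]])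
      (use r[of n] in \<open>auto simp: norm_mult\<close>)
  note cont_P = continuous_on_poisson_kernel[OF w]
  have main: "2 * pi * cmod (h (of_real (r n) * w)) \<le>
      integral {0..2 * pi} (\<lambda>t. max 1 (min (H n t) M) * ?P t) + C / M" if M: "M \<ge> 1" for M n
  proof -
    have hol': "(\<lambda>z. h (of_real (r n) * z)) holomorphic_on cball 0 1"
    proof (rule holomorphic_on_compose_gen[OF _ hol, unfolded o_def])
      show "(*) (complex_of_real (r n)) ` cball 0 1 \<subseteq> ball 0 1"
      proof (clarsimp simp: norm_mult)
        fix z :: complex assume "cmod z \<le> 1"
        then have "\<bar>r n\<bar> * cmod z \<le> \<bar>r n\<bar>" by (intro mult_left_le) auto
        then show "\<bar>r n\<bar> * cmod z < 1" using r[of n] by linarith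
      qed
    qed (intro holomorphic_intros)
    note hi = has_integral_poisson_kernel_mult[OF hol' w]
    have "2 * pi * cmod (h (of_real (r n) * w)) =
        norm (integral {0..2 * pi} (\<lambda>t. h (of_real (r n) * cis t) * of_real (?P t)))"
      using integral_unique[OF hi] by (simp add: norm_mult)
    also have "\<dots> \<le> integral {0..2 * pi} (\<lambda>t. H n t * ?P t)"
      by (intro integral_norm_bound_integral has_integral_integrable[OF hi] integrable_continuous_real
          continuous_intros cont_H cont_P)
        (auto simp: H_def norm_mult poisson_kernel_nonneg[OF w])
    also have "\<dots> \<le> integral {0..2 * pi} (\<lambda>t. max 1 (min (H n t) M) * ?P t
        + (1 / M) * ((1 / (1 - cmod w)\<^sup>2) * (H n t)\<^sup>2))"
    proof (intro integral_le integrable_continuous_real continuous_intros cont_H cont_P)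
      fix t
      have "H n t \<le> max 1 (min (H n t) M) + (H n t)\<^sup>2 / M"
      proof (cases "H n t \<le> M")
        case True
        moreover have "0 \<le> (H n t)\<^sup>2 / M" using M by simp
        ultimately show ?thesis by (simp add: min_def)
      next
        case False
        then have "H n t * M \<le> H n t * H n t" using M by (intro mult_left_mono) auto
        then have "H n t \<le> (H n t)\<^sup>2 / M" using M by (simp add: power2_eq_square field_simps)
        then show ?thesis by simp
      qed
      then have "H n t * ?P t \<le> (max 1 (min (H n t) M) + (H n t)\<^sup>2 / M) * ?P t"
        by (intro mult_right_mono poisson_kernel_nonneg w)
      also have "\<dots> = max 1 (min (H n t) M) * ?P t + (H n t)\<^sup>2 / M * ?P t"
        by (simp add: distrib_right)
      also have "(H n t)\<^sup>2 / M * ?P t \<le> (H n t)\<^sup>2 / M * (1 / (1 - cmod w)\<^sup>2)"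
        using M by (intro mult_left_mono poisson_kernel_le w) auto
      finally show "H n t * ?P t \<le> max 1 (min (H n t) M) * ?P t + (1 / M) * ((1 / (1 - cmod w)\<^sup>2) * (H n t)\<^sup>2)"
        by (simp add: mult_ac)
    qed
    also have "\<dots> = integral {0..2 * pi} (\<lambda>t. max 1 (min (H n t) M) * ?P t)
        + (1 / M) * ((1 / (1 - cmod w)\<^sup>2) * integral {0..2 * pi} (\<lambda>t. (H n t)\<^sup>2))"
      by (subst integral_add)
        (use M w in \<open>auto intro!: integrable_continuous_real continuous_intros cont_H cont_P\<close>)
    also have "(1 / M) * ((1 / (1 - cmod w)\<^sup>2) * integral {0..2 * pi} (\<lambda>t. (H n t)\<^sup>2)) \<le> (1 / M) * C"
      unfolding C_def H_def using M
      by (intro mult_left_mono integral_cmod_power2_circle_le[OF h sq r]) auto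
    finally show ?thesis by simp
  qed
  have le_M: "2 * pi * cmod (h w) \<le> 2 * pi + C / M" if M: "M \<ge> 1" for M
  proof -
    define S where "S = {0..2 * pi} - (N \<union> {2 * pi})"
    \<comment> \<open>The radial limits are only controlled on the half-open interval, so \<open>2\<pi>\<close> is removed too.\<close>
    have neg: "negligible (N \<union> {2 * pi})" using N(1) by (intro negligible_Un) auto
    have spike: "f integrable_on S \<longleftrightarrow> f integrable_on {0..2 * pi}" "integral S f = integral {0..2 * pi} f" for f :: "real \<Rightarrow> real"
    proof -
      have n: "negligible (sym_diff S {0..2 * pi})"
        by (rule negligible_subset[OF neg]) (auto simp: S_def)
      show "f integrable_on S \<longleftrightarrow> f integrable_on {0..2 * pi}"
        by (rule integrable_spike_set_eq[OF n])
      show "integral S f = integral {0..2 * pi} f"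
        by (rule integral_spike_set) (auto intro: negligible_subset[OF neg] simp: S_def)
    qed
    have "(\<lambda>n. integral S (\<lambda>t. max 1 (min (H n t) M) * ?P t)) \<longlonglongrightarrow> integral S ?P"
    proof (rule dominated_convergence(2)[where h = "\<lambda>t. M * ?P t"])
      show "(\<lambda>t. max 1 (min (H n t) M) * ?P t) integrable_on S" for n
        unfolding spike by (intro integrable_continuous_real continuous_intros cont_H cont_P)
      show "(\<lambda>t. M * ?P t) integrable_on S"
        unfolding spike by (intro integrable_continuous_real continuous_intros cont_H cont_P)
      show "norm (max 1 (min (H n t) M) * ?P t) \<le> M * ?P t" for n t
        using M poisson_kernel_nonneg[OF w, of t] by (auto simp: abs_mult intro!: mult_right_mono)
      show "(\<lambda>n. max 1 (min (H n t) M) * ?P t) \<longlonglongrightarrow> ?P t" if "t \<in> S" for t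
      proof -
        have "t \<notin> N" "t \<in> {0..<2 * pi}" using that by (auto simp: S_def)
        then obtain l where l: "((\<lambda>r. h (r *\<^sub>R cis t)) \<longlongrightarrow> l) (at_left 1)" "cmod l \<le> 1"
          using N(2)[of t] by blast
        have "(\<lambda>n. H n t) \<longlonglongrightarrow> cmod l"
          unfolding H_def scaleR_conv_of_real[symmetric]
          by (intro tendsto_norm filterlim_compose[OF l(1) r_at])
        then have "(\<lambda>n. max 1 (min (H n t) M) * ?P t) \<longlonglongrightarrow> max 1 (min (cmod l) M) * ?P t"
          by (intro tendsto_intros)
          moreover have "max 1 (min (cmod l) M) = 1" using l(2) M by simp
        ultimately show ?thesis by simp
      qed
    qed
    then have lim_R: "(\<lambda>n. integral {0..2 * pi} (\<lambda>t. max 1 (min (H n t) M) * ?P t) + C / M) \<longlonglongrightarrow> 2 * pi + C / M"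
      unfolding spike using integral_unique[OF has_integral_poisson_kernel[OF w]]
      by (intro tendsto_intros) simp
    have lim_L: "(\<lambda>n. 2 * pi * cmod (h (of_real (r n) * w))) \<longlonglongrightarrow> 2 * pi * cmod (h w)"
    proof -
      have "isCont h w"
        using hol w by (metis holomorphic_on_imp_continuous_on continuous_on_eq_continuous_at open_ball dist_0_norm mem_ball)
      moreover have "(\<lambda>n. of_real (r n) * w) \<longlonglongrightarrow> of_real 1 * w"
        by (intro tendsto_intros r_lim)
      ultimately show ?thesis
        by (intro tendsto_intros) (auto intro: isCont_tendsto_compose)
    qed
    show ?thesis
      by (rule LIMSEQ_le[OF lim_L lim_R]) (use main[OF M] in blast)
  qed
  have "(\<lambda>n. 2 * pi + C / (real n + 1)) \<longlonglongrightarrow> 2 * pi + 0"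
    by real_asymp
  then have "2 * pi * cmod (h w) \<le> 2 * pi + 0"
    by (rule LIMSEQ_le_const) (auto intro!: exI[of _ 0] le_M)
  then show ?thesis by simp
qed


section \<open>Null sets on the boundary of the ball\<close>

lemma AE_scale_measure_iff:
  assumes "c \<noteq> 0"
  shows "(AE x in scale_measure c M. P x) \<longleftrightarrow> (AE x in M. P x)"
proof -
  have "null_sets (scale_measure c M) = null_sets M"
    using assms by (auto simp: null_sets_def)
  then show ?thesis
    by (simp add: eventually_ae_filter space_scale_measure)
qed

text \<open>Spherical coordinates, with pole \<open>k\<close>, on the sphere of imaginary units.\<close>

definition spherical :: "real \<times> real \<Rightarrow> quat" where
  "spherical x = Quat 0 (sin (fst x) * cos (snd x)) (sin (fst x) * sin (snd x)) (cos (fst x))"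

lemma spherical_imag_unit: "spherical x \<in> imag_units"
proof -
  have "(sin (fst x) * cos (snd x))\<^sup>2 + (sin (fst x) * sin (snd x))\<^sup>2 + (cos (fst x))\<^sup>2
      = (sin (fst x))\<^sup>2 * ((cos (snd x))\<^sup>2 + (sin (snd x))\<^sup>2) + (cos (fst x))\<^sup>2"
    by (simp only: power_mult_distrib distrib_left)
  then have "(norm (spherical x))\<^sup>2 = 1"
    by (simp add: norm_quat_power2 spherical_def)
  then show ?thesis
    by (simp add: imag_units_iff spherical_def power2_eq_1_iff)
      (metis norm_ge_zero not_one_le_zero neg_0_le_iff_le)
qed

lemma measurable_fst_snd_real [measurable]:
  "fst \<in> borel_measurable (borel :: (real \<times> real) measure)"
  "snd \<in> borel_measurable (borel :: (real \<times> real) measure)"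
  by (intro borel_measurable_continuous_onI continuous_intros)+

abbreviation "coord_rect \<equiv> {0..pi} \<times> {0..<2*pi}"

lemma coord_rect_borel: "coord_rect \<in> sets borel"
  by (intro borel_Times) auto

lemma area_imag_units_altdef:
  "area_imag_units = distr (density (restrict_space lborel coord_rect) (\<lambda>x. ennreal (sin (fst x)))) borel spherical"
  by (simp add: area_imag_units_def spherical_def[abs_def] case_prod_beta')

lemma measurable_spherical:
  "spherical \<in> density (restrict_space lborel coord_rect) (\<lambda>x. ennreal (sin (fst x))) \<rightarrow>\<^sub>M borel"
proof -
  have "spherical \<in> borel_measurable lborel"
    unfolding spherical_def[abs_def] by measurable
  then have "spherical \<in> borel_measurable (restrict_space lborel coord_rect)"
    by (rule measurable_restrict_space1)
  then show ?thesis by simp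
qed

lemma space_area_imag_units [simp]: "space area_imag_units = UNIV"
  and sets_area_imag_units [simp, measurable_cong]: "sets area_imag_units = sets borel"
  by (simp_all add: area_imag_units_def)

lemma AE_area_imag_unitsD:
  assumes "AE K in area_imag_units. P K"
  shows "AE x in lborel. x \<in> coord_rect \<longrightarrow> 0 < sin (fst x) \<longrightarrow> P (spherical x)"
proof -
  let ?R = "restrict_space lborel coord_rect"
  have m: "(\<lambda>x. ennreal (sin (fst x))) \<in> borel_measurable ?R"
    by (rule measurable_restrict_space1) measurable
  have "AE x in density ?R (\<lambda>x. ennreal (sin (fst x))). P (spherical x)"
    using assms unfolding area_imag_units_altdef by (rule AE_distrD[OF measurable_spherical])
  then have "AE x in ?R. 0 < ennreal (sin (fst x)) \<longrightarrow> P (spherical x)"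
    by (simp add: AE_density[OF m])
  then show ?thesis
    using coord_rect_borel by (subst (asm) AE_restrict_space_iff) (auto simp: ennreal_less_zero_iff)
qed

lemma AE_area_imag_units: "AE K in area_imag_units. K \<in> imag_units"
proof -
  have "closed imag_units"
    unfolding imag_units_def power2_eq_square by (intro closed_Collect_eq continuous_intros)
  then have "imag_units \<in> sets borel" by simp
  then show ?thesis
    unfolding area_imag_units_altdef
    by (subst AE_distr_iff[OF measurable_spherical]) (auto simp: spherical_imag_unit)
qed

text \<open>
  An affine function of the imaginary unit that vanishes almost everywhere on the sphere is zero: in
  spherical coordinates it is continuous, so it vanishes on the whole closed coordinate rectangle.
\<close>

lemma AE_area_imag_units_affine:
  fixes v :: quat
  assumes "AE K in area_imag_units. v \<bullet> K = d"
  shows "d = 0" and "qI v = 0" and "qJ v = 0" and "qK v = 0"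
proof -
  let ?B = "box (0, 0) (pi, 2 * pi) :: (real \<times> real) set"
  let ?g = "\<lambda>x. v \<bullet> spherical x"
  have cont: "continuous_on S ?g" for S
    unfolding inner_quat_def spherical_def by (auto intro!: continuous_intros)
  obtain N where N: "N \<in> null_sets lborel"
    "\<And>x. x \<in> space lborel - N \<Longrightarrow> x \<in> coord_rect \<longrightarrow> 0 < sin (fst x) \<longrightarrow> ?g x = d"
    using AE_E3[OF AE_area_imag_unitsD[OF assms]] by blast
  have "open {x \<in> ?B. ?g x \<in> - {d}}"
    by (intro continuous_open_preimage[OF cont, unfolded vimage_def Int_def mem_Collect_eq]) auto
  moreover have "{x \<in> ?B. ?g x \<in> - {d}} \<subseteq> N"
  proof
    fix x assume x: "x \<in> {x \<in> ?B. ?g x \<in> - {d}}"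
    then have "x \<in> coord_rect" "0 < sin (fst x)"
      by (auto simp: mem_box Basis_prod_def inner_prod_def mem_Times_iff intro!: sin_gt_zero)
    then show "x \<in> N" using N(2)[of x] x by auto
  qed
  moreover have "negligible N"
    using N(1) by (simp add: negligible_iff_null_sets null_sets_completionI)
  ultimately have empty: "{x \<in> ?B. ?g x \<in> - {d}} = {}"
    using open_not_negligible negligible_subset by blast
  then have gB: "?g x = d" if "x \<in> ?B" for x
    using that empty by blast
  have "closure ?B = cbox (0, 0) (pi, 2 * pi)"
    by (rule closure_box) (auto simp: box_ne_empty Basis_prod_def inner_prod_def)
  then have g: "?g (a, b) = d" if "0 \<le> a" "a \<le> pi" "0 \<le> b" "b \<le> 2 * pi" for a b
    using that by (intro continuous_constant_on_closure[OF cont gB, of "?B"])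
      (auto simp: mem_box Basis_prod_def inner_prod_def)
  \<comment> \<open>The two poles give \<open>d = 0\<close>; \<open>i\<close> and \<open>j\<close> lie on the equator.\<close>
  have "qK v = d" "- qK v = d" "qI v = d" "qJ v = d"
    using g[of 0 0] g[of pi 0] g[of "pi/2" 0] g[of "pi/2" "pi/2"]
    by (simp_all add: inner_quat_def spherical_def)
  then show "d = 0" "qI v = 0" "qJ v = 0" "qK v = 0" by auto
qed

abbreviation "circle_measure \<equiv> restrict_space lborel {0..<2 * pi}"

lemma boundary_measure_altdef:
  "boundary_measure = scale_measure (ennreal (1 / (8 * pi\<^sup>2)))
     (distr (area_imag_units \<Otimes>\<^sub>M circle_measure) borel (\<lambda>(K, t). slice K (cis t)))"
  by (simp add: boundary_measure_def slice_def)

lemma pair_sigma_finite_boundary: "pair_sigma_finite area_imag_units circle_measure"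
proof -
  interpret A: finite_measure area_imag_units
    by standard (simp add: emeasure_area_imag_units)
  interpret C: sigma_finite_measure circle_measure
    by (rule sigma_finite_measure_restrict_space[OF lborel.sigma_finite_measure_axioms]) simp
  show ?thesis ..
qed

lemma measurable_slice_cis:
  "(\<lambda>(K, t). slice K (cis t)) \<in> area_imag_units \<Otimes>\<^sub>M circle_measure \<rightarrow>\<^sub>M borel"
proof -
  let ?M = "area_imag_units \<Otimes>\<^sub>M circle_measure"
  have [measurable]: "fst \<in> borel_measurable ?M"
    using measurable_fst[of area_imag_units circle_measure] by (simp cong: measurable_cong_sets)
  have "snd \<in> ?M \<rightarrow>\<^sub>M circle_measure"
    by (rule measurable_snd)
  then have [measurable]: "snd \<in> borel_measurable ?M"
    by (simp add: measurable_restrict_space2_iff)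
  show ?thesis
    unfolding split_beta slice_def cis.sel scaleR_conv_of_real[symmetric] of_real_def by measurable
qed

lemma AE_boundary_measure_iff:
  assumes "{q. P q} \<in> sets borel"
  shows "(AE q in boundary_measure. P q) \<longleftrightarrow>
    (AE x in area_imag_units \<Otimes>\<^sub>M circle_measure. P (slice (fst x) (cis (snd x))))"
  unfolding boundary_measure_altdef using assms
  by (subst AE_scale_measure_iff, simp add: ennreal_eq_0_iff, subst AE_distr_iff[OF measurable_slice_cis])
    (auto simp: case_prod_beta)

text \<open>
  Fubini's theorem on the boundary, in the order of integration that treats one sphere
  \<open>{cos t + sin t K}\<close> at a time. No measurability of \<open>P\<close> is needed: its exceptional set lies in a
  Borel null set.
\<close>

lemma AE_boundary_measureD:
  assumes "AE q in boundary_measure. P q"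
  shows "AE t in lborel. t \<in> {0..<2 * pi} \<longrightarrow> (AE K in area_imag_units. P (slice K (cis t)))"
proof -
  interpret pair_sigma_finite area_imag_units circle_measure
    by (rule pair_sigma_finite_boundary)
  obtain N where N: "N \<in> null_sets boundary_measure" "\<And>q. q \<in> space boundary_measure - N \<Longrightarrow> P q"
    using AE_E3[OF assms] by blast
  have [simp]: "space boundary_measure = UNIV" "sets boundary_measure = sets borel"
    by (simp_all add: boundary_measure_def space_scale_measure)
  have Nb: "N \<in> sets borel" "{q. q \<notin> N} \<in> sets borel"
    using N(1) by (auto dest!: null_setsD2 simp: Collect_neg_eq)
  have "AE q in boundary_measure. q \<notin> N"
    by (rule AE_not_in[OF N(1)])
  then have AE: "AE x in area_imag_units \<Otimes>\<^sub>M circle_measure. slice (fst x) (cis (snd x)) \<notin> N"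
    using AE_boundary_measure_iff[OF Nb(2)] by simp
  have meas: "{x \<in> space (area_imag_units \<Otimes>\<^sub>M circle_measure). slice (fst x) (cis (snd x)) \<notin> N} \<in> sets (area_imag_units \<Otimes>\<^sub>M circle_measure)"
    using measurable_sets[OF measurable_slice_cis Nb(2)]
    by (simp add: vimage_def Int_def case_prod_beta conj_commute)
  from AE_pair[OF AE] have "AE K in area_imag_units. AE t in circle_measure. slice K (cis t) \<notin> N"
    by simp
  then have "AE t in circle_measure. AE K in area_imag_units. slice K (cis t) \<notin> N"
    using AE_commute[OF meas] by blast
  then have "AE t in circle_measure. AE K in area_imag_units. P (slice K (cis t))"
    using N(2) by (auto elim!: eventually_mono)
  then show ?thesis
    by (subst (asm) AE_restrict_space_iff) auto
qed

lemma AE_lborel_reflect: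
  fixes P :: "real \<Rightarrow> bool"
  assumes "AE t in lborel. P t"
  shows "AE t in lborel. P (c - t)"
proof -
  obtain N where N: "N \<in> null_sets lborel" "\<And>t. t \<in> space lborel - N \<Longrightarrow> P t"
    using AE_E3[OF assms] by blast
  have [measurable]: "N \<in> sets borel" using N(1) by (auto dest: null_setsD2)
  have "AE t in lborel. t \<notin> N" by (rule AE_not_in[OF N(1)])
  then have "AE t in lborel. c + (-1) * t \<notin> N"
    by (intro AE_borel_affine) auto
  then show ?thesis using N(2) by (auto elim!: eventually_mono)
qed

text \<open>
  Conversely, a property that depends only on the real part of a boundary point holds almost
  everywhere if it does so in the angle. The angle \<open>arccos (qRe q)\<close> of \<open>q = cos t + sin t K\<close> is \<open>t\<close>
  or \<open>2\<pi> - t\<close>, so the exceptional set of angles is reflected.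
\<close>

lemma AE_boundary_measureI:
  assumes "AE s in lborel. R s"
  shows "AE q in boundary_measure. norm q = 1 \<and> R (arccos (qRe q))"
proof -
  interpret pair_sigma_finite area_imag_units circle_measure
    by (rule pair_sigma_finite_boundary)
  obtain N where N: "N \<in> null_sets lborel" "\<And>t. t \<in> space lborel - N \<Longrightarrow> R t"
    using AE_E3[OF assms] by blast
  have Nb: "- N \<in> sets borel" using N(1) by (auto dest: null_setsD2)
  define Q where "Q = {q::quat. norm q = 1 \<and> arccos (qRe q) \<notin> N}"
  have Q: "Q \<in> sets borel"
  proof -
    have "arccos \<in> borel_measurable (restrict_space borel {-1..1})"
      by (intro borel_measurable_continuous_on_restrict continuous_on_arccos') 
    from measurable_sets[OF this Nb] have "arccos -` (- N) \<inter> {-1..1} \<in> sets borel"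
      by (simp add: sets_restrict_space_iff)
    moreover have "(\<lambda>q::quat. q \<bullet> 1) \<in> borel_measurable borel"
      by (intro borel_measurable_continuous_onI continuous_intros)
    ultimately have "(\<lambda>q::quat. q \<bullet> 1) -` (arccos -` (- N) \<inter> {-1..1}) \<in> sets borel"
      using measurable_sets_borel by blast
    then have "(\<lambda>q::quat. q \<bullet> 1) -` (arccos -` (- N) \<inter> {-1..1}) \<inter> sphere 0 1 \<in> sets borel"
      by (intro sets.Int) auto
    also have "(\<lambda>q::quat. q \<bullet> 1) -` (arccos -` (- N) \<inter> {-1..1}) \<inter> sphere 0 1 = Q"
    proof -
      have "\<bar>qRe q\<bar> \<le> norm q" for q :: quat
        using Cauchy_Schwarz_ineq2[of q 1] by (simp add: inner_quat_def)
      then have "qRe q \<in> {-1..1}" if "norm q = 1" for q :: quat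
        using that by (metis abs_le_iff atLeastAtMost_iff minus_le_iff)
      then show ?thesis by (auto simp: Q_def inner_quat_def)
    qed
    finally show ?thesis .
  qed
  have AEt: "AE t in circle_measure. arccos (cos t) \<notin> N"
  proof -
    have "AE t in lborel. t \<notin> N" by (rule AE_not_in[OF N(1)])
    moreover from AE_lborel_reflect[OF this] have "AE t in lborel. 2 * pi - t \<notin> N" .
    ultimately have "AE t in lborel. t \<in> {0..<2 * pi} \<longrightarrow> arccos (cos t) \<notin> N"
    proof eventually_elim
      case (elim t)
      show ?case
      proof (cases "t \<le> pi")
        case True
        then show ?thesis using elim by (auto simp: arccos_cos)
      next
        case False
        have "cos t = cos (2 * pi - t)" by simp
        then show ?thesis using elim False arccos_cos[of "2 * pi - t"] by auto
      qed
    qed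
    then show ?thesis by (subst AE_restrict_space_iff) auto
  qed
  have "AE x in area_imag_units \<Otimes>\<^sub>M circle_measure. slice (fst x) (cis (snd x)) \<in> Q"
  proof (rule AE_pair_measure)
    show "{x \<in> space (area_imag_units \<Otimes>\<^sub>M circle_measure). slice (fst x) (cis (snd x)) \<in> Q} \<in> sets (area_imag_units \<Otimes>\<^sub>M circle_measure)"
      using measurable_sets[OF measurable_slice_cis Q]
      by (simp add: vimage_def Int_def case_prod_beta conj_commute)
    show "AE K in area_imag_units. AE t in circle_measure. slice (fst (K, t)) (cis (snd (K, t))) \<in> Q"
      using AE_area_imag_units
    proof eventually_elim
      case (elim K)
      from AEt show ?case
      proof eventually_elim
        case (elim t)
        have "qRe (slice K (cis t)) = cos t"
          using \<open>K \<in> imag_units\<close> by (simp add: slice_def imag_units_iff)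
        then show ?case
          using elim \<open>K \<in> imag_units\<close> by (simp add: Q_def norm_slice)
      qed
    qed
  qed
  then have "AE q in boundary_measure. q \<in> Q"
    using AE_boundary_measure_iff[of "\<lambda>q. q \<in> Q"] Q by simp
  then show ?thesis
  proof eventually_elim
    case (elim q)
    then show ?case using N(2)[of "arccos (qRe q)"] by (simp add: Q_def)
  qed
qed


section \<open>The stem function and radial limits\<close>

text \<open>
  The stem function of \<open>f\<close>, computed from the slice \<open>L\<^sub>I\<close>: \<open>stem_re\<close> and \<open>stem_im\<close> are the
  quaternion-valued functions \<open>b\<close> and \<open>c\<close> of \<open>z = x + iy\<close> with \<open>f (x + yK) = b z + K c z\<close> for all
  imaginary units \<open>K\<close>.
\<close>

definition stem_re :: "(quat \<Rightarrow> quat) \<Rightarrow> quat \<Rightarrow> complex \<Rightarrow> quat" where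
  "stem_re f I z = (1/2) *\<^sub>R (f (slice I z) + f (slice I (cnj z)))"

definition stem_im :: "(quat \<Rightarrow> quat) \<Rightarrow> quat \<Rightarrow> complex \<Rightarrow> quat" where
  "stem_im f I z = - (1/2) *\<^sub>R (I * (f (slice I z) - f (slice I (cnj z))))"

lemma imag_unit_mult_half:
  "I \<in> imag_units \<Longrightarrow> I * (- (1/2) *\<^sub>R (I * x)) = (1/2) *\<^sub>R x"
  by (simp add: imag_unit_square_mult)

lemma half_add_diff:
  fixes x y :: quat
  shows "(1/2) *\<^sub>R (x + y) + (1/2) *\<^sub>R (x - y) = x" "(1/2) *\<^sub>R (x + y) - (1/2) *\<^sub>R (x - y) = y"
  by (simp_all add: quat_eq_iff field_simps)

lemma stem_re_add_stem_im:
  assumes "I \<in> imag_units"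
  shows "stem_re f I z + I * stem_im f I z = f (slice I z)"
    and "stem_re f I z - I * stem_im f I z = f (slice I (cnj z))"
proof -
  have *: "I * stem_im f I z = (1/2) *\<^sub>R (f (slice I z) - f (slice I (cnj z)))"
    unfolding stem_im_def by (rule imag_unit_mult_half[OF assms])
  show "stem_re f I z + I * stem_im f I z = f (slice I z)"
    "stem_re f I z - I * stem_im f I z = f (slice I (cnj z))"
    unfolding stem_re_def * by (rule half_add_diff)+
qed

lemma representation_formula:
  assumes f: "\<And>q. q \<in> ball 0 1 \<Longrightarrow> (\<lambda>n. q ^ n * a n) sums f q"
    and I: "I \<in> imag_units" and K: "K \<in> imag_units" and z: "cmod z < 1"
  shows "f (slice K z) = stem_re f I z + K * stem_im f I z"
proof -
  have pow: "slice L w ^ n = of_real (Re (w ^ n)) + of_real (Im (w ^ n)) * L" if "L \<in> imag_units" for L w n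
    unfolding slice_power[OF that, symmetric] by (simp add: slice_def)
  have series: "(\<lambda>n. (of_real (Re (w ^ n)) + of_real (Im (w ^ n)) * L) * a n) sums f (slice L w)"
    if "L \<in> imag_units" "cmod w < 1" for L w
    using f[of "slice L w"] that by (simp add: norm_slice flip: pow)
  note s1 = series[OF I z]
  have s2: "(\<lambda>n. (of_real (Re (z ^ n)) - of_real (Im (z ^ n)) * I) * a n) sums f (slice I (cnj z))"
    using series[OF I, of "cnj z"] z by (simp flip: complex_cnj_power)
  have "(\<lambda>n. of_real (Re (z ^ n)) * a n) sums stem_re f I z"
  proof -
    have "(\<lambda>n. (1/2) *\<^sub>R ((of_real (Re (z ^ n)) + of_real (Im (z ^ n)) * I) * a n
        + (of_real (Re (z ^ n)) - of_real (Im (z ^ n)) * I) * a n)) sums stem_re f I z"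
      unfolding stem_re_def by (intro sums_scaleR_right sums_add s1 s2)
    then show ?thesis
      by (simp add: algebra_simps del: quat_times_sel flip: scaleR_2)
  qed
  moreover have "(\<lambda>n. of_real (Im (z ^ n)) * a n) sums stem_im f I z"
  proof -
    have "(\<lambda>n. - (1/2) *\<^sub>R (I * ((of_real (Re (z ^ n)) + of_real (Im (z ^ n)) * I) * a n
        - (of_real (Re (z ^ n)) - of_real (Im (z ^ n)) * I) * a n))) sums stem_im f I z"
      unfolding stem_im_def by (intro sums_scaleR_right sums_mult sums_diff s1 s2)
    moreover have "- (1/2) *\<^sub>R (I * ((of_real x + of_real y * I) * q - (of_real x - of_real y * I) * q)) = of_real y * q"
      for x y and q :: quat
    proof -
      have "(of_real x + of_real y * I) * q - (of_real x - of_real y * I) * q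
          = of_real y * I * q + of_real y * I * q"
        by (simp add: algebra_simps)
      also have "of_real y * I * q = y *\<^sub>R (I * q)"
        by (simp add: of_real_def)
      finally have "(of_real x + of_real y * I) * q - (of_real x - of_real y * I) * q = 2 *\<^sub>R (y *\<^sub>R (I * q))"
        by (simp only: scaleR_2)
      then show ?thesis
        using I by (simp only: mult_scaleR_right scaleR_scaleR imag_unit_square_mult)
          (simp add: scaleR_conv_of_real)
    qed
    ultimately show ?thesis by simp
  qed
  ultimately have "(\<lambda>n. of_real (Re (z ^ n)) * a n + K * (of_real (Im (z ^ n)) * a n)) sums
      (stem_re f I z + K * stem_im f I z)"
    by (intro sums_add sums_mult)
  moreover have "of_real x * q + K * (of_real y * q) = (of_real x + of_real y * K) * q" for x y and q :: quat
    by (simp add: of_real_def algebra_simps)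
  ultimately show ?thesis
    using series[OF K z] by (simp add: sums_unique2)
qed

lemma exists_slice:
  fixes q :: quat
  obtains K z where "K \<in> imag_units" "q = slice K z" "0 \<le> Im z"
proof -
  define v where "v = q - of_real (qRe q)"
  have v: "qRe v = 0" by (simp add: v_def)
  show thesis
  proof (cases "v = 0")
    case True
    then have "q = slice (Quat 0 1 0 0) (of_real (qRe q))"
      unfolding slice_of_real by (simp add: v_def)
    moreover have "Quat 0 1 0 0 \<in> imag_units"
      by (simp add: imag_units_iff norm_quat_def inner_quat_def)
    ultimately show ?thesis using that by force
  next
    case False
    then have "sgn v \<in> imag_units"
      using v by (simp add: imag_units_iff norm_sgn) (simp add: sgn_div_norm)
    moreover have "q = slice (sgn v) (Complex (qRe q) (norm v))"
      using False by (simp add: slice_def sgn_div_norm scaleR_conv_of_real[symmetric] v_def)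
    ultimately show ?thesis using that by force
  qed
qed

lemma bounded_linear_slice: "bounded_linear (slice K)"
  by (simp add: slice_def[abs_def] scaleR_conv_of_real[symmetric] of_real_def bounded_linear_intros
     bounded_linear_Re bounded_linear_Im bounded_linear_add bounded_linear_scaleR_const)

lemma eventually_at_left_1:
  "(\<And>r::real. 0 < r \<Longrightarrow> r < 1 \<Longrightarrow> P r) \<Longrightarrow> eventually P (at_left 1)"
  by (rule eventually_at_leftI[of 0]) auto

lemma radial_limitI:
  assumes "((\<lambda>r. f (r *\<^sub>R q)) \<longlongrightarrow> l) (at_left 1)"
  shows "radial_limit_exists f q" and "boundary_value f q = l"
  using assms by (auto simp: radial_limit_exists_def boundary_value_def intro!: tendsto_Lim)

lemma tendsto_boundary_value:
  assumes "radial_limit_exists f q"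
  shows "((\<lambda>r. f (r *\<^sub>R q)) \<longlongrightarrow> boundary_value f q) (at_left 1)"
  using assms radial_limitI(2) unfolding radial_limit_exists_def by blast

text \<open>The stem function of \<open>f\<close> has the radial limits \<open>b\<close> and \<open>c\<close> at the boundary point \<open>z\<close>.\<close>

definition stem_limits :: "(quat \<Rightarrow> quat) \<Rightarrow> quat \<Rightarrow> complex \<Rightarrow> quat \<Rightarrow> quat \<Rightarrow> bool" where
  "stem_limits f I z b c \<longleftrightarrow>
    ((\<lambda>r. stem_re f I (r *\<^sub>R z)) \<longlongrightarrow> b) (at_left 1) \<and> ((\<lambda>r. stem_im f I (r *\<^sub>R z)) \<longlongrightarrow> c) (at_left 1)"

lemma eventually_representation:
  assumes f: "\<And>q. q \<in> ball 0 1 \<Longrightarrow> (\<lambda>n. q ^ n * a n) sums f q"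
    and I: "I \<in> imag_units" and K: "K \<in> imag_units"
  shows "eventually (\<lambda>r. f (r *\<^sub>R slice K (cis t)) = stem_re f I (r *\<^sub>R cis t) + K * stem_im f I (r *\<^sub>R cis t)) (at_left 1)"
  using representation_formula[OF f I K] by (intro eventually_at_left_1) (simp flip: slice_scaleR)

lemma tendsto_of_stem_limits:
  assumes f: "\<And>q. q \<in> ball 0 1 \<Longrightarrow> (\<lambda>n. q ^ n * a n) sums f q"
    and I: "I \<in> imag_units" and K: "K \<in> imag_units"
    and lim: "stem_limits f I (cis t) b c"
  shows "((\<lambda>r. f (r *\<^sub>R slice K (cis t))) \<longlongrightarrow> b + K * c) (at_left 1)"
proof -
  have "((\<lambda>r. stem_re f I (r *\<^sub>R cis t) + K * stem_im f I (r *\<^sub>R cis t)) \<longlongrightarrow> b + K * c) (at_left 1)"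
    using lim by (auto simp: stem_limits_def intro!: tendsto_intros)
  then show ?thesis
    using tendsto_cong[OF eventually_representation[OF f I K]] by simp
qed

text \<open>
  Two radial limits on one sphere \<open>{cos t + sin t K}\<close> determine all the others, because
  \<open>b + K c\<close> and \<open>b + L c\<close> determine \<open>b\<close> and \<open>c\<close>.
\<close>

lemma stem_limits_of_two_radial_limits:
  assumes f: "\<And>q. q \<in> ball 0 1 \<Longrightarrow> (\<lambda>n. q ^ n * a n) sums f q"
    and I: "I \<in> imag_units" and K: "K \<in> imag_units" "L \<in> imag_units" "K \<noteq> L"
    and ex: "radial_limit_exists f (slice K (cis t))" "radial_limit_exists f (slice L (cis t))"
  shows "\<exists>b c. stem_limits f I (cis t) b c"
proof -
  let ?b = "\<lambda>r. stem_re f I (r *\<^sub>R cis t)" and ?c = "\<lambda>r. stem_im f I (r *\<^sub>R cis t)"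
  obtain k l where "((\<lambda>r. f (r *\<^sub>R slice K (cis t))) \<longlongrightarrow> k) (at_left 1)"
    "((\<lambda>r. f (r *\<^sub>R slice L (cis t))) \<longlongrightarrow> l) (at_left 1)"
    using ex unfolding radial_limit_exists_def by blast
  then have kl: "((\<lambda>r. ?b r + K * ?c r) \<longlongrightarrow> k) (at_left 1)" "((\<lambda>r. ?b r + L * ?c r) \<longlongrightarrow> l) (at_left 1)"
    using tendsto_cong[OF eventually_representation[OF f I K(1)]]
      tendsto_cong[OF eventually_representation[OF f I K(2)]] by simp_all
  have "((\<lambda>r. inverse (K - L) * ((?b r + K * ?c r) - (?b r + L * ?c r))) \<longlongrightarrow> inverse (K - L) * (k - l)) (at_left 1)"
    by (intro tendsto_intros kl)
  moreover have "inverse (K - L) * ((?b r + K * ?c r) - (?b r + L * ?c r)) = ?c r" for r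
  proof -
    have "(?b r + K * ?c r) - (?b r + L * ?c r) = (K - L) * ?c r"
      by (simp add: left_diff_distrib)
    then show ?thesis
      using K(3) by (simp flip: mult.assoc)
  qed
  ultimately have c: "(?c \<longlongrightarrow> inverse (K - L) * (k - l)) (at_left 1)"
    by simp
  have "((\<lambda>r. (?b r + K * ?c r) - K * ?c r) \<longlongrightarrow> k - K * (inverse (K - L) * (k - l))) (at_left 1)"
    by (intro tendsto_intros kl c)
  then show ?thesis
    using c unfolding stem_limits_def by auto
qed

section \<open>Unimodular spheres of boundary values\<close>

text \<open>
  A function \<open>f\<close> with square summable coefficients \<open>a\<close> and its splitting \<open>F + G J\<close> on the slice
  \<open>L\<^sub>I\<close>.
\<close>

locale split_hardy =
  fixes f :: "quat \<Rightarrow> quat" and a :: "nat \<Rightarrow> quat" and I J :: quat and F G :: "complex \<Rightarrow> complex"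
  assumes f_sums: "\<And>q. q \<in> ball 0 1 \<Longrightarrow> (\<lambda>n. q ^ n * a n) sums f q"
    and square_summable: "summable (\<lambda>n. (norm (a n))\<^sup>2)"
    and I: "I \<in> imag_units" and J: "J \<in> imag_units" and orth: "orthogonal J I"
    and split: "\<And>z. z \<in> ball 0 1 \<Longrightarrow> f (slice I z) = slice I (F z) + slice I (G z) * J"
begin

text \<open>
  The radial limits of \<open>f\<close> exist on the whole sphere \<open>{cos t + sin t K}\<close> and have norm \<open>1\<close>
  there.
\<close>

definition unimodular_at :: "real \<Rightarrow> bool" where
  "unimodular_at t \<longleftrightarrow> (\<exists>b c. stem_limits f I (cis t) b c \<and> (\<forall>K\<in>imag_units. norm (b + K * c) = 1))"

text \<open>The boundary condition on the components of the splitting, at the single point \<open>z\<close>.\<close>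

definition split_condition :: "complex \<Rightarrow> bool" where
  "split_condition z \<longleftrightarrow> radial_limit_exists F z \<and> radial_limit_exists G z \<and>
       radial_limit_exists F (cnj z) \<and> radial_limit_exists G (cnj z) \<and>
       (cmod (boundary_value F z))\<^sup>2 + (cmod (boundary_value G z))\<^sup>2 = 1 \<and>
       boundary_value F z * boundary_value G (cnj z) =
         boundary_value F (cnj z) * boundary_value G z"

lemma split_components:
  assumes "cmod z < 1"
  shows "F z = slice_proj I (f (slice I z))" and "G z = slice_proj I (f (slice I z) * - J)"
  using slice_proj_slice_mult[OF I J orth] split[of z] assms by simp_all

lemma split_radial_limits:
  assumes "cmod z = 1" and "((\<lambda>r. f (slice I (r *\<^sub>R z))) \<longlongrightarrow> p) (at_left 1)"
  shows "((\<lambda>r. F (r *\<^sub>R z)) \<longlongrightarrow> slice_proj I p) (at_left 1)"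
    and "((\<lambda>r. G (r *\<^sub>R z)) \<longlongrightarrow> slice_proj I (p * - J)) (at_left 1)"
proof -
  note lin = bounded_linear.tendsto[OF bounded_linear_slice_proj]
  have ev: "eventually (\<lambda>r. slice_proj I (f (slice I (r *\<^sub>R z))) = F (r *\<^sub>R z)) (at_left 1)"
    "eventually (\<lambda>r. slice_proj I (f (slice I (r *\<^sub>R z)) * - J) = G (r *\<^sub>R z)) (at_left 1)"
    using assms(1) by (auto intro!: eventually_at_left_1 simp: split_components)
  show "((\<lambda>r. F (r *\<^sub>R z)) \<longlongrightarrow> slice_proj I p) (at_left 1)"
    by (rule Lim_transform_eventually[OF lin[OF assms(2)] ev(1)])
  show "((\<lambda>r. G (r *\<^sub>R z)) \<longlongrightarrow> slice_proj I (p * - J)) (at_left 1)"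
    by (rule Lim_transform_eventually[OF lin[OF tendsto_mult_right[OF assms(2)]] ev(2)])
qed

text \<open>
  The splitting condition at \<open>cis t\<close> controls the norm on one of the two points of the sphere in
  \<open>L\<^sub>I\<close> only; a unimodular sphere needs it on both.
\<close>

lemma unimodular_at_iff:
  "unimodular_at t \<longleftrightarrow> split_condition (cis t) \<and>
    (cmod (boundary_value F (cnj (cis t))))\<^sup>2 + (cmod (boundary_value G (cnj (cis t))))\<^sup>2 = 1"
proof
  assume "unimodular_at t"
  then obtain b c where bc: "stem_limits f I (cis t) b c" "\<forall>K\<in>imag_units. norm (b + K * c) = 1"
    unfolding unimodular_at_def by blast
  define p where "p = b + I * c"
  define q where "q = b - I * c"
  have stem: "((\<lambda>r. stem_re f I (r *\<^sub>R cis t)) \<longlongrightarrow> b) (at_left 1)" "((\<lambda>r. stem_im f I (r *\<^sub>R cis t)) \<longlongrightarrow> c) (at_left 1)"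
    using bc unfolding stem_limits_def by auto
  have lp: "((\<lambda>r. f (slice I (r *\<^sub>R cis t))) \<longlongrightarrow> p) (at_left 1)"
    unfolding stem_re_add_stem_im(1)[OF I, symmetric] p_def by (intro tendsto_intros stem)
  have lq: "((\<lambda>r. f (slice I (r *\<^sub>R cnj (cis t)))) \<longlongrightarrow> q) (at_left 1)"
  proof -
    have "((\<lambda>r. f (slice I (cnj (r *\<^sub>R cis t)))) \<longlongrightarrow> q) (at_left 1)"
      unfolding stem_re_add_stem_im(2)[OF I, symmetric] q_def by (intro tendsto_intros stem)
    then show ?thesis by simp
  qed
  note L1 = split_radial_limits[OF _ lp, simplified] and L2 = split_radial_limits[OF _ lq, simplified]
  have eq: "l = slice I (slice_proj I l) + slice I (slice_proj I (l * - J)) * J"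
    if "cmod z = 1" "((\<lambda>r. f (slice I (r *\<^sub>R z))) \<longlongrightarrow> l) (at_left 1)" for z l
  proof (rule tendsto_unique[OF _ that(2)])
    have "((\<lambda>r. slice I (F (r *\<^sub>R z)) + slice I (G (r *\<^sub>R z)) * J) \<longlongrightarrow>
        slice I (slice_proj I l) + slice I (slice_proj I (l * - J)) * J) (at_left 1)"
      by (intro tendsto_intros bounded_linear.tendsto[OF bounded_linear_slice] split_radial_limits that)
    then show "((\<lambda>r. f (slice I (r *\<^sub>R z))) \<longlongrightarrow>
        slice I (slice_proj I l) + slice I (slice_proj I (l * - J)) * J) (at_left 1)"
      by (rule Lim_transform_eventually) (use that(1) in \<open>auto intro!: eventually_at_left_1 simp: split\<close>)
  qed simp
  have "(\<forall>K\<in>imag_units. norm (b + K * c) = 1) \<longleftrightarrow>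
      (cmod (slice_proj I p))\<^sup>2 + (cmod (slice_proj I (p * - J)))\<^sup>2 = 1 \<and>
      (cmod (slice_proj I q))\<^sup>2 + (cmod (slice_proj I (q * - J)))\<^sup>2 = 1 \<and>
      slice_proj I p * slice_proj I (q * - J) = slice_proj I q * slice_proj I (p * - J)"
    by (rule norm_sphere_eq_1_iff[OF I J orth])
      (use eq[OF _ lp] eq[OF _ lq] in \<open>simp_all add: p_def q_def\<close>)
  then show "split_condition (cis t) \<and>
    (cmod (boundary_value F (cnj (cis t))))\<^sup>2 + (cmod (boundary_value G (cnj (cis t))))\<^sup>2 = 1"
    using bc(2) L1 L2 by (simp add: split_condition_def radial_limitI)
next
  assume *: "split_condition (cis t) \<and>
    (cmod (boundary_value F (cnj (cis t))))\<^sup>2 + (cmod (boundary_value G (cnj (cis t))))\<^sup>2 = 1"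
  define p where "p = slice I (boundary_value F (cis t)) + slice I (boundary_value G (cis t)) * J"
  define q where "q = slice I (boundary_value F (cnj (cis t))) + slice I (boundary_value G (cnj (cis t))) * J"
  define b where "b = (1/2) *\<^sub>R (p + q)"
  define c where "c = - (1/2) *\<^sub>R (I * (p - q))"
  have lim: "((\<lambda>r. f (slice I (r *\<^sub>R z))) \<longlongrightarrow> slice I (boundary_value F z) + slice I (boundary_value G z) * J) (at_left 1)"
    if "cmod z = 1" "radial_limit_exists F z" "radial_limit_exists G z" for z
  proof -
    have "((\<lambda>r. slice I (F (r *\<^sub>R z)) + slice I (G (r *\<^sub>R z)) * J) \<longlongrightarrow>
        slice I (boundary_value F z) + slice I (boundary_value G z) * J) (at_left 1)"
      by (intro tendsto_intros bounded_linear.tendsto[OF bounded_linear_slice] tendsto_boundary_value that)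
    then show ?thesis
      by (rule Lim_transform_eventually) (use that(1) in \<open>auto intro!: eventually_at_left_1 simp: split\<close>)
  qed
  have lp: "((\<lambda>r. f (slice I (r *\<^sub>R cis t))) \<longlongrightarrow> p) (at_left 1)"
    and lq: "((\<lambda>r. f (slice I (r *\<^sub>R cnj (cis t)))) \<longlongrightarrow> q) (at_left 1)"
    unfolding p_def q_def using * by (auto intro!: lim simp: split_condition_def)
  have "stem_limits f I (cis t) b c"
    unfolding stem_limits_def stem_re_def stem_im_def b_def c_def complex_cnj_scaleR
    by (intro conjI tendsto_intros lp lq)
  moreover have Ic: "I * c = (1/2) *\<^sub>R (p - q)"
    unfolding c_def by (rule imag_unit_mult_half[OF I])
  have "b + I * c = p" "b - I * c = q"
    unfolding Ic b_def by (rule half_add_diff)+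
  then have "\<forall>K\<in>imag_units. norm (b + K * c) = 1"
    using * norm_sphere_eq_1_iff[OF I J orth, of b c] unfolding p_def q_def split_condition_def by auto
  ultimately show "unimodular_at t"
    unfolding unimodular_at_def by blast
qed

text \<open>
  Radial limits of norm \<open>1\<close> at almost every point of a sphere are radial limits of norm \<open>1\<close> at every
  point of it.
\<close>

lemma unimodular_at_of_AE:
  assumes "AE K in area_imag_units.
    radial_limit_exists f (slice K (cis t)) \<and> norm (boundary_value f (slice K (cis t))) = 1"
  shows "unimodular_at t"
proof -
  define good where "good K \<longleftrightarrow> K \<in> imag_units \<and> radial_limit_exists f (slice K (cis t)) \<and>
      norm (boundary_value f (slice K (cis t))) = 1" for K
  have AE_good: "AE K in area_imag_units. good K"
    using assms AE_area_imag_units by eventually_elim (simp add: good_def)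
  \<comment> \<open>A single point is a null set of the sphere; here this follows from the lemma on affine functions.\<close>
  obtain K L where KL: "good K" "good L" "K \<noteq> L"
  proof (rule ccontr)
    assume "\<not> thesis"
    then have uniq: "K = L" if "good K" "good L" for K L
      using \<open>\<And>K L. good K \<Longrightarrow> good L \<Longrightarrow> K \<noteq> L \<Longrightarrow> thesis\<close> that by blast
    show False
    proof (cases "\<exists>K. good K")
      case True
      then obtain K where K: "good K" by blast
      then have KK: "K \<bullet> K = 1"
        by (simp add: good_def norm_imag_unit dot_square_norm)
      have "AE L in area_imag_units. K \<bullet> L = 1"
        using AE_good
      proof eventually_elim
        case (elim L)
        then show ?case using uniq[OF K, of L] KK by simp
      qed
      then show False
        using AE_area_imag_units_affine(1) by force
    next
      case False
      have "AE L in area_imag_units. 0 \<bullet> L = (1::real)"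
        using AE_good by eventually_elim (use False in blast)
      then show False
        using AE_area_imag_units_affine(1)[of 0 1] by simp
    qed
  qed
  obtain b c where bc: "stem_limits f I (cis t) b c"
    using stem_limits_of_two_radial_limits[OF f_sums I, of K L t] KL by (auto simp: good_def)
  have norm_eq: "norm (b + K * c) = 1" if "good K" for K
    using radial_limitI(2)[OF tendsto_of_stem_limits[OF f_sums I _ bc, of K]] that by (simp add: good_def)
  let ?d = "(1 - (norm b)\<^sup>2 - (norm c)\<^sup>2) / 2"
  have "AE K in area_imag_units. (b * qcnj c) \<bullet> K = ?d"
    using AE_good
  proof eventually_elim
    case (elim K)
    then show ?case
      using norm_add_mult_imag_unit[of K b c] norm_eq[of K] by (simp add: good_def)
  qed
  note affine = AE_area_imag_units_affine[OF this]
  have "norm (b + K * c) = 1" if "K \<in> imag_units" for K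
  proof -
    have "(b * qcnj c) \<bullet> K = 0"
      using affine(2-4) that unfolding inner_quat_def imag_units_iff by simp
    then have "(norm (b + K * c))\<^sup>2 = 1"
      using norm_add_mult_imag_unit[OF that, of b c] affine(1) by simp
    then show ?thesis
      by (simp add: power2_eq_1_iff) (metis norm_ge_zero not_one_le_zero neg_0_le_iff_le)
  qed
  then show ?thesis
    using bc unfolding unimodular_at_def by blast
qed

text \<open>
  The bound in the ball is reduced to the complex one: with a unit quaternion \<open>u\<close> that makes
  \<open>f (slice K w) u\<close> real and positive, the projection onto \<open>L\<^sub>K\<close> of \<open>f u\<close> on the slice
  \<open>L\<^sub>K\<close> is an \<open>H\<^sup>2\<close> function that attains the value \<open>\<bar>f (slice K w)\<bar>\<close> at \<open>w\<close>.
\<close>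

lemma norm_le_1:
  assumes uni: "AE t in lborel. t \<in> {0..<2 * pi} \<longrightarrow> unimodular_at t"
    and K: "K \<in> imag_units" and w: "cmod w < 1"
  shows "norm (f (slice K w)) \<le> 1"
proof (cases "f (slice K w) = 0")
  case False
  define u where "u = inverse (f (slice K w)) * of_real (norm (f (slice K w)))"
  have u: "norm u = 1" "f (slice K w) * u = of_real (norm (f (slice K w)))"
    using False by (simp_all add: u_def norm_mult norm_inverse flip: mult.assoc)
  define h where "h z = slice_proj K (f (slice K z) * u)" for z
  have "cmod (h w) \<le> 1"
  proof (rule cmod_le_1_of_radial_limits[where h = h and w = w and a = "\<lambda>n. slice_proj K (a n * u)"])
    fix z :: complex assume "z \<in> ball 0 1"
    then have "(\<lambda>n. slice K z ^ n * a n) sums f (slice K z)"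
      using K by (intro f_sums) (simp add: norm_slice)
    then have "(\<lambda>n. slice_proj K (slice K z ^ n * a n * u)) sums h z"
      unfolding h_def by (intro bounded_linear.sums[OF bounded_linear_slice_proj] sums_mult2)
    moreover have "slice_proj K (slice K z ^ n * a n * u) = slice_proj K (a n * u) * z ^ n" for n
      using slice_proj_mult[OF K, of "z ^ n" "a n * u"] K by (simp add: slice_power mult.assoc mult.commute)
    ultimately show "(\<lambda>n. slice_proj K (a n * u) * z ^ n) sums h z"
      by simp
  next
    have "cmod (slice_proj K (a n * u)) \<le> norm (a n)" for n
      using norm_slice_proj_le[OF K, of "a n * u"] u by (simp add: norm_mult)
    then show "summable (\<lambda>n. (cmod (slice_proj K (a n * u)))\<^sup>2)"
      by (intro summable_comparison_test'[OF square_summable]) (simp add: power_mono)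
  next
    show "AE t in lborel. t \<in> {0..<2 * pi} \<longrightarrow>
      (\<exists>l. ((\<lambda>r. h (r *\<^sub>R cis t)) \<longlongrightarrow> l) (at_left 1) \<and> cmod l \<le> 1)"
      using uni
    proof eventually_elim
      case (elim t)
      show ?case
      proof
        assume "t \<in> {0..<2 * pi}"
        then obtain b c where bc: "stem_limits f I (cis t) b c" "norm (b + K * c) = 1"
          using elim K unfolding unimodular_at_def by blast
        have "((\<lambda>r. h (r *\<^sub>R cis t)) \<longlongrightarrow> slice_proj K ((b + K * c) * u)) (at_left 1)"
          unfolding h_def slice_scaleR
          by (intro bounded_linear.tendsto[OF bounded_linear_slice_proj] tendsto_mult_right
              tendsto_of_stem_limits[OF f_sums I K bc(1)])
        moreover have "cmod (slice_proj K ((b + K * c) * u)) \<le> 1"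
          using norm_slice_proj_le[OF K, of "(b + K * c) * u"] bc(2) u by (simp add: norm_mult)
        ultimately show "\<exists>l. ((\<lambda>r. h (r *\<^sub>R cis t)) \<longlongrightarrow> l) (at_left 1) \<and> cmod l \<le> 1"
          by blast
      qed
    qed
  qed (fact w)
  moreover have "h w = of_real (norm (f (slice K w)))"
    unfolding h_def u(2) using slice_proj_slice[OF K] by (metis slice_of_real)
  ultimately show ?thesis by simp
qed simp

lemma inner_function_iff_AE_unimodular:
  assumes "slice_regular f"
  shows "inner_function f \<longleftrightarrow> (AE t in lborel. t \<in> {0..<2 * pi} \<longrightarrow> unimodular_at t)"
proof
  assume "inner_function f"
  then have "AE q in boundary_measure. radial_limit_exists f q \<and> norm (boundary_value f q) = 1"
    unfolding inner_function_def by blast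
  from AE_boundary_measureD[OF this]
  show "AE t in lborel. t \<in> {0..<2 * pi} \<longrightarrow> unimodular_at t"
    by eventually_elim (use unimodular_at_of_AE in blast)
next
  assume uni: "AE t in lborel. t \<in> {0..<2 * pi} \<longrightarrow> unimodular_at t"
  have le_1: "norm (f q) \<le> 1" if "q \<in> ball 0 1" for q
  proof -
    obtain K z where "K \<in> imag_units" "q = slice K z"
      by (rule exists_slice)
    then show ?thesis
      using norm_le_1[OF uni, of K z] that by (simp add: norm_slice)
  qed
  have "AE q in boundary_measure. radial_limit_exists f q \<and> norm (boundary_value f q) = 1"
    using AE_boundary_measureI[OF uni]
  proof eventually_elim
    case (elim q)
    obtain K z where Kz: "K \<in> imag_units" "q = slice K z" "0 \<le> Im z"
      by (rule exists_slice)
    define t where "t = arccos (Re z)"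
    have z: "cmod z = 1" using elim Kz by (simp add: norm_slice)
    then have Re: "\<bar>Re z\<bar> \<le> 1" using abs_Re_le_cmod[of z] by simp
    then have t: "0 \<le> t" "t \<le> pi" "cos t = Re z"
      unfolding t_def by (auto intro: arccos_lbound arccos_ubound)
    have t_less: "t < 2 * pi" using t(2) pi_gt_zero by linarith
    have "sin t = Im z"
    proof -
      have "(sin t)\<^sup>2 = (Im z)\<^sup>2"
        using z t(3) cmod_power2[of z] sin_cos_squared_add[of t] by simp
      then show ?thesis
        using Kz(3) sin_ge_zero[OF t(1,2)] by simp
    qed
    then have z_cis: "z = cis t" using t(3) by (simp add: complex_eq_iff)
    have "qRe q = Re z" using Kz by (simp add: slice_def imag_units_iff)
    then have "unimodular_at t"
      using elim t(1) t_less by (simp add: t_def)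
    then obtain b c where bc: "stem_limits f I (cis t) b c" "norm (b + K * c) = 1"
      using Kz(1) unfolding unimodular_at_def by blast
    show ?case
      using radial_limitI[OF tendsto_of_stem_limits[OF f_sums I Kz(1) bc(1)]] bc(2) Kz(2) z_cis by simp
  qed
  then show "inner_function f"
    unfolding inner_function_def hardy_inf_def using assms le_1
    by (auto intro!: boundedI[of _ 1])
qed

text \<open>
  Reflecting the exceptional null set under \<open>t \<mapsto> 2\<pi> - t\<close> gives the splitting condition at
  \<open>cis t\<close> and at its conjugate simultaneously.
\<close>

lemma AE_unimodular_iff:
  "(AE t in lborel. t \<in> {0..<2 * pi} \<longrightarrow> unimodular_at t) \<longleftrightarrow>
   (AE t in lborel. t \<in> {0..<2 * pi} \<longrightarrow> split_condition (cis t))"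
proof
  assume "AE t in lborel. t \<in> {0..<2 * pi} \<longrightarrow> unimodular_at t"
  then show "AE t in lborel. t \<in> {0..<2 * pi} \<longrightarrow> split_condition (cis t)"
    by eventually_elim (simp add: unimodular_at_iff)
next
  assume *: "AE t in lborel. t \<in> {0..<2 * pi} \<longrightarrow> split_condition (cis t)"
  from * AE_lborel_reflect[OF *, of "2 * pi"]
  show "AE t in lborel. t \<in> {0..<2 * pi} \<longrightarrow> unimodular_at t"
  proof eventually_elim
    case (elim t)
    show ?case
    proof
      assume t: "t \<in> {0..<2 * pi}"
      have "split_condition (cnj (cis t))"
      proof (cases "t = 0")
        case True
        then show ?thesis using elim(1) t by simp
      next
        case False
        moreover have "cis (2 * pi - t) = cnj (cis t)"
          by (simp add: complex_eq_iff)
        ultimately show ?thesis using elim(2) t by simp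
      qed
      then show "unimodular_at t"
        unfolding unimodular_at_iff using elim(1) t by (simp add: split_condition_def)
    qed
  qed
qed

end

theorem theorem3p5:
  fixes f :: "quat \<Rightarrow> quat" and I J :: quat and F G :: "complex \<Rightarrow> complex"
  assumes "f \<in> hardy2"
    and "I \<in> imag_units" and "J \<in> imag_units" and "orthogonal J I"
    and "F holomorphic_on ball 0 1" and "G holomorphic_on ball 0 1"
    and "\<And>z. z \<in> ball 0 1 \<Longrightarrow> f (slice I z) = slice I (F z) + slice I (G z) * J"
  shows "inner_function f \<longleftrightarrow>
    (AE t in lebesgue_on {0..<2*pi}. let z = cis t in
       radial_limit_exists F z \<and> radial_limit_exists G z \<and>
       radial_limit_exists F (cnj z) \<and> radial_limit_exists G (cnj z) \<and>
       (cmod (boundary_value F z))\<^sup>2 + (cmod (boundary_value G z))\<^sup>2 = 1 \<and>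
       boundary_value F z * boundary_value G (cnj z) =
         boundary_value F (cnj z) * boundary_value G z)"
proof -
  obtain a where a: "\<And>q. q \<in> ball 0 1 \<Longrightarrow> (\<lambda>n. q ^ n * a n) sums f q" "summable (\<lambda>n. (norm (a n))\<^sup>2)"
    and reg: "slice_regular f"
    using assms(1) unfolding hardy2_def by blast
  interpret split_hardy f a I J F G
    by standard (use a assms in auto)
  have "inner_function f \<longleftrightarrow> (AE t in lborel. t \<in> {0..<2 * pi} \<longrightarrow> split_condition (cis t))"
    using inner_function_iff_AE_unimodular[OF reg] AE_unimodular_iff by simp
  also have "\<dots> \<longleftrightarrow> (AE t in lebesgue_on {0..<2 * pi}. split_condition (cis t))"
    by (subst AE_restrict_space_iff) (simp_all add: AE_completion_iff)
  finally show ?thesis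
    by (simp add: split_condition_def Let_def)
qed

end
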